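(* Assume $1\leq p <\infty$, let $\frac1p+\frac1q=1$, and take $\phi\in L^q(\mathbb{R}^d)$ with $P|\phi|\in L^\infty(\mathbb{R}^d)$ and $\int_{\mathbb{R}^d} \phi\, dx = 1$. Then for all $f\in L^p(\mathbb{R}^d)$, $$\|f\|_p \approx \| Tf \|_{\ell^\infty(\ell^p)} = \sup_{j>0} \left( \sum_{k\in\mathbb{Z}^d} | \langle f , \phi_{j,k} \rangle|^p \right)^{1/p} |\det b| ,$$ i.e. each side is bounded by a positive constant, independent of $f$, times the other.
   Context: Fix $d \in \mathbb{N}$. The dilation matrices $a_j$ ($j=1,2,3,\ldots$) are invertible $d \times d$ real matrices that are expanding: $\|a_j^{-1}\| \to 0$ as $j \to \infty$ (operator norm on $\mathbb{R}^d$). The translation matrix $b$ is an invertible $d \times d$ real matrix. Functions are complex-valued, $1/\infty=0$, and $j>0$ means $j=1,2,3,\ldots$. For $\phi \in L^q$ put $\phi_{j,k}(x) = |\det a_j|^{1/q}\phi(a_j x - bk)$, $x \in \mathbb{R}^d$, $k \in \mathbb{Z}^d$, and $\langle f,\phi_{j,k}\rangle = \int_{\mathbb{R}^d} f\,\overline{\phi_{j,k}}\,dx$. The analysis operator is $Tf = \{ |\det b| \langle f,\phi_{j,k}\rangle\}_{j>0,k\in\mathbb{Z}^d}$. The norm on $\ell^\infty(\ell^p)$ is $\|c\|_{\ell^\infty(\ell^p)}=\sup_{j>0}\big(\sum_{k\in\mathbb{Z}^d}|c_{j,k}|^p\big)^{1/p}$. The periodization of a function $f$ is $Pf(x) = |\det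 b|\sum_{k\in\mathbb{Z}^d} f(x-bk)$. (The condition $P|\phi|\in L^\infty$ implies $\phi\in L^1$.) *)

theory Defs
  imports "HOL-Analysis.Analysis" "HOL-Probability.Essential_Supremum"
begin

text \<open>Norms, powers and sums of moduli take values in \<^typ>\<open>ennreal\<close>, so that divergence is
  recorded as \<open>\<infinity>\<close> rather than as a junk real value. The power is meant for positive
  exponents \<open>r\<close> only.\<close>

definition epowr :: "ennreal \<Rightarrow> real \<Rightarrow> ennreal"
  where "epowr t r = (if t = \<infinity> then \<infinity> else ennreal (enn2real t powr r))"

definition eLp_norm :: "ennreal \<Rightarrow> 'a measure \<Rightarrow> ('a \<Rightarrow> ennreal) \<Rightarrow> ennreal"
  where "eLp_norm p M g =
    (if p = \<infinity> then esssup M g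
     else epowr (\<integral>\<^sup>+ x. epowr (g x) (enn2real p) \<partial>M) (1 / enn2real p))"

definition Lp_norm :: "ennreal \<Rightarrow> 'a measure \<Rightarrow> ('a \<Rightarrow> complex) \<Rightarrow> ennreal"
  where "Lp_norm p M f = eLp_norm p M (\<lambda>x. ennreal (norm (f x)))"

definition Lp_space :: "ennreal \<Rightarrow> 'a measure \<Rightarrow> ('a \<Rightarrow> complex) set"
  where "Lp_space p M = {f \<in> borel_measurable M. Lp_norm p M f < \<infinity>}"

text \<open>The version of \<open>Lp_space\<close> for functions with values in \<open>[0, \<infinity>]\<close>.\<close>

definition eLp_space :: "ennreal \<Rightarrow> 'a measure \<Rightarrow> ('a \<Rightarrow> ennreal) set"
  where "eLp_space p M = {g \<in> borel_measurable M. eLp_norm p M g < \<infinity>}"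

text \<open>The lattice \<open>\<int>\<^sup>d\<close> is the type \<^typ>\<open>int ^ 'd\<close>, embedded in \<^typ>\<open>real ^ 'd\<close>.\<close>

definition vec_of_int :: "int ^ 'd \<Rightarrow> real ^ 'd"
  where "vec_of_int k = (\<chi> i. real_of_int (k $ i))"

text \<open>Periodization is used only for nonnegative functions, with the series summed in \<open>[0, \<infinity>]\<close>.\<close>

definition periodization :: "real ^ 'd ^ 'd \<Rightarrow> (real ^ 'd \<Rightarrow> ennreal) \<Rightarrow> real ^ 'd \<Rightarrow> ennreal"
  where "periodization b g x =
    ennreal \<bar>det b\<bar> * (\<Sum>\<^sub>\<infinity>k\<in>UNIV. g (x - b *v vec_of_int k))"

text \<open>For \<open>q = \<infinity>\<close> the exponent \<open>1 / q\<close> is \<open>0\<close> and the normalizing factor is \<open>1\<close>.\<close>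

definition affine_system ::
    "ennreal \<Rightarrow> (nat \<Rightarrow> real ^ 'd ^ 'd) \<Rightarrow> real ^ 'd ^ 'd \<Rightarrow> (real ^ 'd \<Rightarrow> complex) \<Rightarrow>
     nat \<Rightarrow> int ^ 'd \<Rightarrow> real ^ 'd \<Rightarrow> complex"
  where "affine_system q a b \<phi> j k x =
    complex_of_real (\<bar>det (a j)\<bar> powr enn2real (1 / q)) * \<phi> (a j *v x - b *v vec_of_int k)"

definition pairing :: "(real ^ 'd \<Rightarrow> complex) \<Rightarrow> (real ^ 'd \<Rightarrow> complex) \<Rightarrow> complex"
  where "pairing f g = (\<integral>x. f x * cnj (g x) \<partial>lebesgue)"

definition analysis_op ::
    "ennreal \<Rightarrow> (nat \<Rightarrow> real ^ 'd ^ 'd) \<Rightarrow> real ^ 'd ^ 'd \<Rightarrow> (real ^ 'd \<Rightarrow> complex) \<Rightarrow>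
     (real ^ 'd \<Rightarrow> complex) \<Rightarrow> nat \<Rightarrow> int ^ 'd \<Rightarrow> complex"
  where "analysis_op q a b \<phi> f j k =
    complex_of_real \<bar>det b\<bar> * pairing f (affine_system q a b \<phi> j k)"

text \<open>Sequences are indexed by scales \<open>j > 0\<close>; the value at \<open>j = 0\<close> is ignored.\<close>

definition linf_lp_norm :: "real \<Rightarrow> (nat \<Rightarrow> 'k \<Rightarrow> complex) \<Rightarrow> ennreal"
  where "linf_lp_norm p c =
    (SUP j\<in>{0<..}. epowr (\<Sum>\<^sub>\<infinity>k\<in>UNIV. ennreal (norm (c j k) powr p)) (1 / p))"

definition expanding :: "(nat \<Rightarrow> real ^ 'd ^ 'd) \<Rightarrow> bool"
  where "expanding a \<longleftrightarrow> (\<lambda>j. onorm (\<lambda>v. matrix_inv (a j) *v v)) \<longlonglongrightarrow> 0"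

end

(* Write T_j f for the coefficient sequence of f at scale j.

   Upper bound: apply Jensen's inequality with weight |phi(a_j x - b k)| and sum over k; the
   periodization of |phi| bounds the sum of the weights.

   Lower bound: let S_j be the synthesis operator of the indicator function of the cell b[0,1)^d, so
   that the p-norm of S_j T_j g is a constant times that of T_j g. For bounded continuous g, S_j T_j g
   tends to g pointwise because the a_j are expanding and phi has integral 1, so Fatou's lemma gives
   the bound. The upper bound and the density of the bounded continuous functions in L^p carry it
   over to all of L^p. Only p-th powers of norms are used, with |x + y|^p <= 2^p (|x|^p + |y|^p) in
   place of Minkowski's inequality. *)
theory Submission
  imports Defs
begin

text \<open>Continuity and boundedness of g serve the pointwise limit: the value of S_j T_j g at x
  is an average of g, weighted by the conjugate of phi, over points whose distance from x tends to
  0, and a multiple of |phi| is a majorant. For a general f in L^p no such majorant is at hand,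
  hence the detour through a dense class. The error g - f is again in L^p, and its coefficients are
  controlled at all scales at once because the upper constant does not depend on j. For p-th powers,
  with W the integral of |phi| and M an a.e. bound for the sum of the weights, the constants are
  W^(p-1) M above and 4^p |det b| below. The factor 2^p is paid twice, once for comparing f with g
  and once for comparing their coefficients; |det b| is the volume of the cell. The normalizing
  factor is used with exponent 1 - 1/p throughout, so p = 1 with q = infinity is no separate case.
  As f and phi are only Lebesgue measurable, the substitutions y = a_j x - b k take place in the
  completed measure.\<close>

section \<open>Linear change of variables\<close>

text \<open>The change of variables theorems of the library require a well-ordered index type, whereas the
  induction over elementary matrices is available for every finite index type.\<close>

lemma measure_shear:
  fixes S :: "(real ^ 'n) set"
  assumes "m \<noteq> n" "S \<in> lmeasurable"
  defines "h \<equiv> \<lambda>x::real ^ 'n. \<chi> i. if i = m then x $ m + x $ n else x $ i"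
  shows "h ` S \<in> lmeasurable" "measure lebesgue (h ` S) = measure lebesgue S"
proof -
  have lin: "linear h"
    unfolding h_def by (rule linearI) (auto simp: algebra_simps vec_eq_iff)
  have "measure lebesgue (h ` cbox a b) = 1 * measure lebesgue (cbox a b)" for a b
  proof (cases "cbox a b = {}")
    case False
    define v where "v = (a $ n) *\<^sub>R (axis n 1 :: real ^ 'n)"
    have box: "cbox a b = (+) v ` cbox (a - v) (b - v)"
      by (simp add: cbox_translation[symmetric])
    have "h ` cbox a b = (+) (h v) ` h ` cbox (a - v) (b - v)"
      unfolding box image_image using linear_add[OF lin] by simp
    then have "measure lebesgue (h ` cbox a b) = measure lebesgue (h ` cbox (a - v) (b - v))"
      by (simp add: measure_translation)
    also have "\<dots> = measure lebesgue (cbox (a - v) (b - v))"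
      unfolding h_def using False box
      by (intro measure_shear_interval[OF assms(1)]) (auto simp: v_def)
    also have "\<dots> = measure lebesgue (cbox a b)"
      unfolding box by (rule measure_translation[symmetric])
    finally show ?thesis by simp
  qed simp
  from measure_linear_sufficient[OF lin assms(2) this]
  show "h ` S \<in> lmeasurable" "measure lebesgue (h ` S) = measure lebesgue S" by auto
qed

lemma borel_measurable_matrix_vector_mult [measurable]:
  "(\<lambda>x. A *v x) \<in> borel_measurable borel" for A :: "real ^ 'n ^ 'm"
  by (intro borel_measurable_continuous_onI matrix_vector_mult_linear_continuous_on)

text \<open>Invariance of the measure is shown for the inverse shear \<open>t\<close>: the preimage
  of a box under \<open>t\<close> is its image under \<open>s\<close>, whose volume is known from
  \<open>measure_shear\<close>. Pushing forward along \<open>t\<close> then turns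
  \<open>h (s x)\<close> into \<open>h (s (t x)) = h x\<close>.\<close>

lemma nn_integral_lborel_shear:
  fixes h :: "real ^ 'n \<Rightarrow> ennreal"
  assumes "m \<noteq> n" and [measurable]: "h \<in> borel_measurable borel"
  shows "(\<integral>\<^sup>+x. h (\<chi> i. if i = m then x $ m + x $ n else x $ i) \<partial>lborel) = (\<integral>\<^sup>+x. h x \<partial>lborel)"
proof -
  define s t :: "real ^ 'n \<Rightarrow> real ^ 'n"
    where "s = (\<lambda>x. \<chi> i. if i = m then x $ m + x $ n else x $ i)"
      and "t = (\<lambda>x. \<chi> i. if i = m then x $ m - x $ n else x $ i)"
  have st: "s (t x) = x" "t (s x) = x" for x
    using assms(1) by (auto simp: s_def t_def vec_eq_iff)
  have "linear s" "linear t"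
    unfolding s_def t_def by (auto intro!: linearI simp: algebra_simps vec_eq_iff)
  then have [measurable]: "s \<in> borel_measurable borel" "t \<in> borel_measurable borel"
    by (auto intro!: borel_measurable_continuous_onI linear_continuous_on simp: linear_linear)
  have t: "lborel = distr lborel borel t"
  proof (rule lborel_eqI)
    fix l u :: "real ^ 'n" assume lu: "\<And>b. b \<in> Basis \<Longrightarrow> l \<bullet> b \<le> u \<bullet> b"
    have vim: "t -` box l u = s ` box l u"
      using st by (auto simp: image_iff) metis+
    have [measurable]: "s ` box l u \<in> sets borel"
      unfolding vim[symmetric] using measurable_sets[of t borel borel "box l u"] by simp
    have "emeasure (distr lborel borel t) (box l u) = emeasure lebesgue (s ` box l u)"
      by (simp add: emeasure_distr vim)
    also have "\<dots> = emeasure lebesgue (box l u)"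
      using measure_shear[OF assms(1), of "box l u"]
      by (simp add: s_def emeasure_eq_measure2 fmeasurableD2)
    also have "\<dots> = (\<Prod>b\<in>Basis. (u - l) \<bullet> b)"
      using lu by (simp add: emeasure_lborel_box)
    finally show "emeasure (distr lborel borel t) (box l u) = (\<Prod>b\<in>Basis. (u - l) \<bullet> b)" .
  qed simp
  have "(\<integral>\<^sup>+x. h (s x) \<partial>lborel) = (\<integral>\<^sup>+x. h (s (t x)) \<partial>lborel)"
    by (subst t) (simp add: nn_integral_distr)
  then have "(\<integral>\<^sup>+x. h (s x) \<partial>lborel) = (\<integral>\<^sup>+x. h x \<partial>lborel)"
    by (simp only: st)
  then show ?thesis
    unfolding s_def .
qed

text \<open>The preimage of a box is the box whose corners are permuted by the inverse of
  \<open>p\<close>, so the same side lengths are multiplied in another order.\<close>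

lemma nn_integral_lborel_permute_coordinates:
  fixes h :: "real ^ 'n \<Rightarrow> ennreal"
  assumes "p permutes UNIV" and [measurable]: "h \<in> borel_measurable borel"
  shows "(\<integral>\<^sup>+x. h (\<chi> i. x $ p i) \<partial>lborel) = (\<integral>\<^sup>+x. h x \<partial>lborel)"
proof -
  define s :: "real ^ 'n \<Rightarrow> real ^ 'n" where "s = (\<lambda>x. \<chi> i. x $ p i)"
  have "linear s"
    unfolding s_def by (auto intro!: linearI simp: algebra_simps vec_eq_iff)
  then have [measurable]: "s \<in> borel_measurable borel"
    by (auto intro!: borel_measurable_continuous_onI linear_continuous_on simp: linear_linear)
  have s: "lborel = distr lborel borel s"
  proof (rule lborel_eqI)
    fix l u :: "real ^ 'n" assume lu: "\<And>b. b \<in> Basis \<Longrightarrow> l \<bullet> b \<le> u \<bullet> b"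
    have lu': "l $ i \<le> u $ i" for i
      using lu[of "axis i 1"] by (simp add: inner_axis)
    define q where "q = inv p"
    have q: "q permutes UNIV" "\<And>i. p (q i) = i" "\<And>i. q (p i) = i"
      using assms(1) by (auto simp: q_def permutes_inv permutes_inverses)
    have "s -` box l u = box (\<chi> i. l $ q i) (\<chi> i. u $ q i)"
      by (auto simp: s_def mem_box_cart q) (metis q(2,3))+
    then have "emeasure (distr lborel borel s) (box l u) = (\<Prod>i\<in>UNIV. u $ q i - l $ q i)"
      using lu'
      by (simp add: emeasure_distr emeasure_lborel_box_eq Basis_vec_def cart_eq_inner_axis[symmetric]
            inner_axis axis_eq_axis  prod.UNION_disjoint)
    also have "(\<Prod>i\<in>UNIV. u $ q i - l $ q i) = (\<Prod>i\<in>UNIV. u $ i - l $ i)"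
      using prod.permute[OF q(1), of "\<lambda>i. u $ i - l $ i"] by (simp add: o_def)
    also have "\<dots> = (\<Prod>b\<in>Basis. (u - l) \<bullet> b)"
      by (simp add: Basis_vec_def prod.UNION_disjoint inner_axis axis_eq_axis)
    finally show "emeasure (distr lborel borel s) (box l u) = (\<Prod>b\<in>Basis. (u - l) \<bullet> b)" .
  qed simp
  have "(\<integral>\<^sup>+x. h (s x) \<partial>lborel) = (\<integral>\<^sup>+x. h x \<partial>lborel)"
    by (subst (2) s) (simp add: nn_integral_distr)
  then show ?thesis
    unfolding s_def .
qed

lemma nn_integral_lborel_diagonal:
  fixes h :: "real ^ 'n \<Rightarrow> ennreal" and c :: "'n \<Rightarrow> real"
  assumes c: "\<And>i. c i \<noteq> 0" and [measurable]: "h \<in> borel_measurable borel"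
  shows "ennreal \<bar>\<Prod>i\<in>UNIV. c i\<bar> * (\<integral>\<^sup>+x. h (\<chi> i. c i * x $ i) \<partial>lborel) = (\<integral>\<^sup>+x. h x \<partial>lborel)"
proof -
  define s :: "real ^ 'n \<Rightarrow> real ^ 'n" where "s = (\<lambda>x. \<chi> i. c i * x $ i)"
  \<comment> \<open>\<open>d\<close> carries the factors over from indices to basis vectors, the
    form used by \<open>lborel_affine_euclidean\<close>; the choice is unambiguous because
    \<open>axis i 1\<close> determines \<open>i\<close>.\<close>
  define d where "d b = c (SOME i. b = axis i (1::real))" for b
  have [simp]: "d (axis i 1) = c i" for i
    unfolding d_def by (rule someI2[of _ i]) (auto simp: axis_eq_axis)
  have T: "0 + (\<Sum>j\<in>Basis. (d j * (x \<bullet> j)) *\<^sub>R j) = s x" for x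
  proof -
    have "(\<Sum>j\<in>Basis. (d j * (x \<bullet> j)) *\<^sub>R j) = (\<Sum>i\<in>UNIV. (c i * x $ i) *\<^sub>R axis i 1)"
      by (simp add: Basis_vec_def sum.UNION_disjoint axis_eq_axis inner_axis)
    then show ?thesis
      by (simp add: s_def vec_eq_iff axis_def if_distrib[of "\<lambda>z. _ * z"] cong: if_cong)
  qed
  have "linear s"
    unfolding s_def by (auto intro!: linearI simp: algebra_simps vec_eq_iff)
  then have [measurable]: "s \<in> borel_measurable borel"
    by (auto intro!: borel_measurable_continuous_onI linear_continuous_on simp: linear_linear)
  have "lborel = density (distr lborel borel s) (\<lambda>_. ennreal (\<Prod>j\<in>Basis. \<bar>d j\<bar>))"
    unfolding T[symmetric, abs_def] using c
    by (intro lborel_affine_euclidean) (auto simp: Basis_vec_def)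
  also have "(\<Prod>j\<in>Basis. \<bar>d j\<bar>) = \<bar>\<Prod>i\<in>UNIV. c i\<bar>"
    by (simp add: Basis_vec_def prod.UNION_disjoint axis_eq_axis abs_prod)
  finally have s: "lborel = density (distr lborel borel s) (\<lambda>_. ennreal \<bar>\<Prod>i\<in>UNIV. c i\<bar>)" .
  have "ennreal \<bar>\<Prod>i\<in>UNIV. c i\<bar> * (\<integral>\<^sup>+x. h (s x) \<partial>lborel) = (\<integral>\<^sup>+x. h x \<partial>lborel)"
    by (subst (2) s) (simp add: nn_integral_density nn_integral_distr nn_integral_cmult)
  then show ?thesis
    unfolding s_def .
qed

text \<open>Every matrix is a product of matrices with a zero row, diagonal matrices, transpositions
  and shears. A zero row contradicts \<open>det A \<noteq> 0\<close>, the other types are the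
  preceding lemmas, and determinants multiply.\<close>

lemma nn_integral_lborel_matrix:
  fixes A :: "real ^ 'n ^ 'n" and h :: "real ^ 'n \<Rightarrow> ennreal"
  assumes "det A \<noteq> 0" "h \<in> borel_measurable borel"
  shows "ennreal \<bar>det A\<bar> * (\<integral>\<^sup>+x. h (A *v x) \<partial>lborel) = (\<integral>\<^sup>+x. h x \<partial>lborel)"
proof -
  \<comment> \<open>The claim is quantified over \<open>h\<close> because in the product case the
    hypothesis for the right factor is applied to the composition of \<open>h\<close> with the left
    factor.\<close>
  have "det A \<noteq> 0 \<longrightarrow> (\<forall>h \<in> borel_measurable borel.
      ennreal \<bar>det A\<bar> * (\<integral>\<^sup>+x. h (A *v x) \<partial>lborel) = (\<integral>\<^sup>+x. h x \<partial>lborel))"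
  proof (induction A rule: induct_matrix_elementary_alt)
    case (1 A B)
    show ?case
    proof safe
      fix h :: "real ^ 'n \<Rightarrow> ennreal" assume [measurable]: "h \<in> borel_measurable borel"
      assume "det (A ** B) \<noteq> 0"
      then have nz: "det A \<noteq> 0" "det B \<noteq> 0" by (auto simp: det_mul)
      have "ennreal \<bar>det (A ** B)\<bar> * (\<integral>\<^sup>+x. h ((A ** B) *v x) \<partial>lborel)
        = ennreal \<bar>det A\<bar> * (ennreal \<bar>det B\<bar> * (\<integral>\<^sup>+x. h (A *v (B *v x)) \<partial>lborel))"
        by (simp add: det_mul abs_mult ennreal_mult mult.assoc matrix_vector_mul_assoc)
      also have "\<dots> = ennreal \<bar>det A\<bar> * (\<integral>\<^sup>+x. h (A *v x) \<partial>lborel)"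
        using 1(2)[rule_format, OF nz(2), of "\<lambda>x. h (A *v x)"] by simp
      also have "\<dots> = (\<integral>\<^sup>+x. h x \<partial>lborel)"
        using 1(1) nz by auto
      finally show "ennreal \<bar>det (A ** B)\<bar> * (\<integral>\<^sup>+x. h ((A ** B) *v x) \<partial>lborel) = (\<integral>\<^sup>+x. h x \<partial>lborel)" .
    qed
  next
    case (2 A i)
    then show ?case by (simp add: det_zero_row(2))
  next
    case (3 A)
    have "A *v x = (\<chi> i. A $ i $ i * x $ i)" for x
    proof -
      have "(\<Sum>j\<in>UNIV. A $ i $ j * x $ j) = A $ i $ i * x $ i" for i
        using 3 by (subst sum.remove[of _ i]) (auto intro!: sum.neutral)
      then show ?thesis
        by (simp add: matrix_vector_mult_def vec_eq_iff)
    qed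
    then show ?case
      using nn_integral_lborel_diagonal[of "\<lambda>i. A $ i $ i"] 3 by (auto simp: det_diagonal)
  next
    case (4 m n)
    let ?A = "\<chi> i j. mat 1 $ i $ Transposition.transpose m n j :: real ^ 'n ^ 'n"
    have p: "Transposition.transpose m n permutes UNIV"
      by (simp add: permutes_swap_id)
    have det: "\<bar>det ?A\<bar> = 1"
      using det_permute_columns[OF p, of "mat 1 :: real ^ 'n ^ 'n"] by (simp add: abs_mult sign_swap_id)
    have entry: "(mat 1 :: real ^ 'n ^ 'n) $ i $ Transposition.transpose m n j
        = (if j = Transposition.transpose m n i then 1 else 0)" for i j
    proof -
      have "i = Transposition.transpose m n j \<longleftrightarrow> j = Transposition.transpose m n i"
        by (metis transpose_involutory)
      then show ?thesis by (simp only: mat_def vec_lambda_beta)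
    qed
    have "?A *v x = (\<chi> i. x $ Transposition.transpose m n i)" for x
    proof -
      have "(\<Sum>j\<in>UNIV. ?A $ i $ j * x $ j) = x $ Transposition.transpose m n i" for i
        unfolding vec_lambda_beta entry
        by (simp add: if_distrib[of "\<lambda>z. z * _"] cong: if_cong)
      then show ?thesis
        unfolding matrix_vector_mult_def by (simp only:)
    qed
    then show ?case
      using nn_integral_lborel_permute_coordinates[OF p] det by auto
  next
    case (5 m n)
    let ?A = "\<chi> i j. of_bool (i = m \<and> j = n \<or> i = j) :: real ^ 'n ^ 'n"
    have "?A = (\<chi> k. if k = m then row m (mat 1) + 1 *s row n (mat 1) else row k (mat 1))"
      using 5 by (auto simp: vec_eq_iff row_def mat_def)
    then have det: "det ?A = 1"
      using det_row_operation[OF 5, of "mat 1 :: real ^ 'n ^ 'n" 1] by simp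
    have "?A *v x = (\<chi> i. if i = m then x $ m + x $ n else x $ i)" for x
    proof -
      have "(\<Sum>j\<in>UNIV. of_bool (i = m \<and> j = n \<or> i = j) * x $ j)
          = (\<Sum>j\<in>UNIV. (if j = i then x $ j else 0) + (if j = n then of_bool (i = m) * x $ j else 0))" for i
        using 5 by (intro sum.cong) auto
      then show ?thesis
        by (simp add: matrix_vector_mult_def vec_eq_iff sum.distrib)
    qed
    then show ?case
      using nn_integral_lborel_shear[OF 5] det by auto
  qed
  then show ?thesis using assms by blast
qed

text \<open>The identity is first proved for \<open>lborel\<close> and then completed. Completion
  commutes with pushing forward along \<open>T\<close> because the pushforward has the same null
  sets as \<open>lborel\<close>: the two differ by the nonzero constant
  \<open>\<bar>det A\<bar>\<close>.\<close>

lemma lebesgue_affine_matrix: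
  fixes A :: "real ^ 'n ^ 'n" and c :: "real ^ 'n"
  defines "T \<equiv> \<lambda>x. A *v x - c"
  assumes "det A \<noteq> 0"
  shows "lebesgue = density (distr lebesgue lebesgue T) (\<lambda>_. ennreal \<bar>det A\<bar>)"
    and "T \<in> lebesgue \<rightarrow>\<^sub>M lebesgue"
proof -
  have [measurable]: "T \<in> borel_measurable borel"
    unfolding T_def by measurable
  have lborel: "lborel = density (distr lborel borel T) (\<lambda>_. ennreal \<bar>det A\<bar>)"
  proof (rule measure_eqI)
    fix X :: "(real ^ 'n) set" assume "X \<in> sets lborel"
    then have [measurable]: "X \<in> sets borel" by simp
    have "emeasure (density (distr lborel borel T) (\<lambda>_. ennreal \<bar>det A\<bar>)) X
      = ennreal \<bar>det A\<bar> * (\<integral>\<^sup>+x. indicator X (A *v x - c) \<partial>lborel)"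
      by (simp add: nn_integral_indicator[symmetric] nn_integral_density nn_integral_distr
          nn_integral_cmult T_def del: nn_integral_indicator)
    also have "\<dots> = (\<integral>\<^sup>+x. indicator X (x - c) \<partial>lborel)"
      using nn_integral_lborel_matrix[OF assms(2), of "\<lambda>x. indicator X (x - c)"] by simp
    also have "\<dots> = (\<integral>\<^sup>+x. indicator X x \<partial>distr lborel borel ((+) (- c)))"
      by (subst nn_integral_distr) auto
    also have "\<dots> = emeasure lborel X"
      by (simp add: lborel_distr_plus)
    finally show "emeasure lborel X = emeasure (density (distr lborel borel T) (\<lambda>_. ennreal \<bar>det A\<bar>)) X"
      by simp
  qed simp
  have null: "null_sets (distr lebesgue lborel T) = null_sets lborel"
  proof -
    have "emeasure lborel X = ennreal \<bar>det A\<bar> * emeasure (distr lebesgue lborel T) X" if "X \<in> sets lborel" for X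
      using that by (subst lborel) (simp add: emeasure_density nn_integral_cmult distr_completion cong: distr_cong)
    then show ?thesis
      using assms(2) by (auto simp: null_sets_def)
  qed
  show "T \<in> lebesgue \<rightarrow>\<^sub>M lebesgue"
    by (rule completion.measurable_completion2) (auto simp: null measurable_completion)
  have "lebesgue = completion (density (distr lborel borel T) (\<lambda>_. ennreal \<bar>det A\<bar>))"
    using lborel by simp
  also have "\<dots> = density (completion (distr lebesgue lborel T)) (\<lambda>_. ennreal \<bar>det A\<bar>)"
    using assms(2) by (subst completion_density_eq) (auto simp: distr_completion cong: distr_cong)
  also have "completion (distr lebesgue lborel T) = distr lebesgue lebesgue T"
    by (rule completion.completion_distr_eq) (auto simp: null measurable_completion)
  finally show "lebesgue = density (distr lebesgue lebesgue T) (\<lambda>_. ennreal \<bar>det A\<bar>)" .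
qed

lemma borel_measurable_lebesgue_affine:
  fixes A :: "real ^ 'n ^ 'n"
  assumes "det A \<noteq> 0" "h \<in> borel_measurable lebesgue"
  shows "(\<lambda>x. h (A *v x - c)) \<in> borel_measurable lebesgue"
  using measurable_compose[OF lebesgue_affine_matrix(2)[OF assms(1)] assms(2)] .

lemma nn_integral_lebesgue_affine:
  fixes A :: "real ^ 'n ^ 'n" and h :: "real ^ 'n \<Rightarrow> ennreal"
  assumes "det A \<noteq> 0" and [measurable]: "h \<in> borel_measurable lebesgue"
  shows "(\<integral>\<^sup>+x. h x \<partial>lebesgue) = ennreal \<bar>det A\<bar> * (\<integral>\<^sup>+x. h (A *v x - c) \<partial>lebesgue)"
proof -
  note [measurable] = lebesgue_affine_matrix(2)[OF assms(1), of c]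
    borel_measurable_lebesgue_affine[OF assms, of c]
  have "(\<integral>\<^sup>+x. h x \<partial>lebesgue) =
      (\<integral>\<^sup>+x. ennreal \<bar>det A\<bar> * h x \<partial>distr lebesgue lebesgue (\<lambda>x. A *v x - c))"
    by (subst lebesgue_affine_matrix(1)[OF assms(1), of c], subst nn_integral_density) auto
  also have "\<dots> = (\<integral>\<^sup>+x. ennreal \<bar>det A\<bar> * h (A *v x - c) \<partial>lebesgue)"
    by (rule nn_integral_distr) auto
  also have "\<dots> = ennreal \<bar>det A\<bar> * (\<integral>\<^sup>+x. h (A *v x - c) \<partial>lebesgue)"
    by (rule nn_integral_cmult) auto
  finally show ?thesis .
qed

lemma integral_lebesgue_affine:
  fixes A :: "real ^ 'n ^ 'n" and h :: "real ^ 'n \<Rightarrow> 'a::{banach, second_countable_topology}"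
  assumes "det A \<noteq> 0" and [measurable]: "h \<in> borel_measurable lebesgue"
  shows "(\<integral>x. h x \<partial>lebesgue) = \<bar>det A\<bar> *\<^sub>R (\<integral>x. h (A *v x - c) \<partial>lebesgue)"
proof -
  note [measurable] = lebesgue_affine_matrix(2)[OF assms(1), of c]
  have "(\<integral>x. h x \<partial>lebesgue) =
      (\<integral>x. \<bar>det A\<bar> *\<^sub>R h x \<partial>distr lebesgue lebesgue (\<lambda>x. A *v x - c))"
    by (subst lebesgue_affine_matrix(1)[OF assms(1), of c], subst integral_density) auto
  also have "\<dots> = (\<integral>x. \<bar>det A\<bar> *\<^sub>R h (A *v x - c) \<partial>lebesgue)"
    by (rule integral_distr) auto
  also have "\<dots> = \<bar>det A\<bar> *\<^sub>R (\<integral>x. h (A *v x - c) \<partial>lebesgue)"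
    by (rule integral_scaleR_right)
  finally show ?thesis .
qed

section \<open>Unordered sums in [0, infinity]\<close>

lemma infsum_ennreal_eq_SUP:
  fixes f :: "'a \<Rightarrow> ennreal"
  shows "infsum f A = (SUP F\<in>{F. finite F \<and> F \<subseteq> A}. sum f F)"
  by (rule nonneg_infsum_complete) simp

text \<open>Makes the integral calculus available for unordered sums: linearity and the exchange of
  sum and integral are then instances of facts about \<open>nn_integral\<close>. For infinite
  \<open>A\<close> an enumeration turns the integral into a series whose partial sums are finite
  subsums.\<close>

lemma infsum_eq_nn_integral_count_space:
  fixes f :: "'a \<Rightarrow> ennreal"
  assumes "countable A"
  shows "infsum f A = (\<integral>\<^sup>+x. f x \<partial>count_space A)"
proof (rule antisym)
  show "infsum f A \<le> (\<integral>\<^sup>+x. f x \<partial>count_space A)"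
    unfolding infsum_ennreal_eq_SUP
  proof (safe intro!: SUP_least)
    fix F assume F: "finite F" "F \<subseteq> A"
    have "sum f F = (\<integral>\<^sup>+x. f x * indicator F x \<partial>count_space A)"
      using F by (subst nn_integral_count_space'[of F]) (auto simp: indicator_def)
    also have "\<dots> \<le> (\<integral>\<^sup>+x. f x \<partial>count_space A)"
      by (intro nn_integral_mono) (auto simp: indicator_def)
    finally show "sum f F \<le> (\<integral>\<^sup>+x. f x \<partial>count_space A)" .
  qed
next
  show "(\<integral>\<^sup>+x. f x \<partial>count_space A) \<le> infsum f A"
  proof (cases "finite A")
    case True
    then show ?thesis by (simp add: nn_integral_count_space_finite)
  next
    case False
    have fin: "bij_betw (from_nat_into A) UNIV A"
      using bij_betw_from_nat_into assms False by blast
    have "(\<integral>\<^sup>+x. f x \<partial>count_space A) = (\<Sum>n. f (from_nat_into A n))"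
      by (simp add: nn_integral_bij_count_space[OF fin, symmetric] nn_integral_count_space_nat)
    also have "\<dots> \<le> infsum f A"
    proof (rule suminf_le_const)
      fix n
      have "(\<Sum>i<n. f (from_nat_into A i)) = sum f (from_nat_into A ` {..<n})"
        using fin by (subst sum.reindex) (auto simp: bij_betw_def inj_on_def)
      also have "\<dots> \<le> infsum f A"
        unfolding infsum_ennreal_eq_SUP using fin
        by (intro SUP_upper) (auto simp: bij_betw_def)
      finally show "(\<Sum>i<n. f (from_nat_into A i)) \<le> infsum f A" .
    qed simp
    finally show ?thesis .
  qed
qed

lemma infsum_cmult_ennreal:
  fixes f :: "'a \<Rightarrow> ennreal"
  assumes "countable A"
  shows "(\<Sum>\<^sub>\<infinity>x\<in>A. c * f x) = c * infsum f A"
  by (simp add: infsum_eq_nn_integral_count_space assms nn_integral_cmult)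

section \<open>The upper bound\<close>

text \<open>Weighted AM-GM for \<open>u powr p * t powr (1 - p)\<close> and \<open>t\<close> with
  weights \<open>1 / p\<close> and \<open>1 - 1 / p\<close>, whose geometric mean is
  \<open>u\<close>. The bound is affine in \<open>u powr p\<close> and sharp at
  \<open>u = t\<close>, so it can be integrated before \<open>t\<close> is chosen.\<close>

lemma powr_weighted_young:
  fixes u t p :: real
  assumes "0 \<le> u" "0 < t" "1 \<le> p"
  shows "u \<le> t powr (1 - p) / p * u powr p + t * (1 - 1 / p)"
proof (cases "u = 0")
  case False
  with assms have u: "u > 0" by simp
  define a where "a = u powr p * t powr (1 - p)"
  have "a powr (1 / p) = u * t powr ((1 - p) / p)"
    using u assms by (simp add: a_def powr_mult powr_powr)
  then have "a powr (1 / p) * t powr (1 - 1 / p) = u * (t powr ((1 - p) / p) * t powr (1 - 1 / p))"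
    by simp
  also have "t powr ((1 - p) / p) * t powr (1 - 1 / p) = 1"
    unfolding powr_add[symmetric] using assms by (simp add: diff_divide_distrib)
  finally have "a powr (1 / p) * t powr (1 - 1 / p) = u" by simp
  moreover have "a powr (1 / p) * t powr (1 - 1 / p) \<le> 1 / p * a + (1 - 1 / p) * t"
    using u assms by (intro Youngs_inequality_0) (auto simp: a_def)
  ultimately show ?thesis
    by (simp add: a_def mult_ac)
qed (use assms in auto)

text \<open>The affine bound of \<open>powr_weighted_young\<close> is integrated against the weight,
  and then \<open>t\<close> is optimized. Finiteness of the integral on the left is part of the
  conclusion; it later yields the absolute convergence of the pairings.\<close>

lemma nn_integral_weighted_jensen:
  fixes f w :: "'a \<Rightarrow> real"
  assumes [measurable]: "f \<in> borel_measurable M" "w \<in> borel_measurable M"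
    and nonneg: "\<And>x. 0 \<le> f x" "\<And>x. 0 \<le> w x"
    and p: "1 \<le> p"
    and W: "(\<integral>\<^sup>+x. ennreal (w x) \<partial>M) = ennreal W" "0 < W"
    and F: "(\<integral>\<^sup>+x. ennreal (f x powr p * w x) \<partial>M) = ennreal F" "0 \<le> F"
  obtains I where "(\<integral>\<^sup>+x. ennreal (f x * w x) \<partial>M) = ennreal I" "0 \<le> I"
    "I powr p \<le> W powr (p - 1) * F"
proof (cases "F = 0")
  case True
  then have "AE x in M. f x powr p * w x = 0"
    using F nonneg by (simp add: nn_integral_0_iff_AE)
  then have "AE x in M. ennreal (f x * w x) = 0"
    by eventually_elim (use p in auto)
  then have "(\<integral>\<^sup>+x. ennreal (f x * w x) \<partial>M) = ennreal 0"
    by (simp add: nn_integral_0_iff_AE)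
  then show ?thesis
    using that[of 0] True by simp
next
  case False
  with F have "F > 0" by simp
  \<comment> \<open>The weighted \<open>p\<close>-th power mean of \<open>f\<close>: for
    \<open>p > 1\<close> it minimizes \<open>\<alpha> * F + \<beta> * W\<close>, and the value there
    is \<open>t * W\<close>. It is positive only for \<open>F > 0\<close>, hence the case
    distinction.\<close>
  define t where "t = (F / W) powr (1 / p)"
  have t: "t > 0" "t powr p = F / W"
    using \<open>F > 0\<close> W p by (auto simp: t_def powr_powr)
  define \<alpha> \<beta> where "\<alpha> = t powr (1 - p) / p" and "\<beta> = t * (1 - 1 / p)"
  have ab: "0 \<le> \<alpha>" "0 \<le> \<beta>"
    using t p by (auto simp: \<alpha>_def \<beta>_def)
  have "(\<integral>\<^sup>+x. ennreal (f x * w x) \<partial>M)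
      \<le> (\<integral>\<^sup>+x. ennreal \<alpha> * ennreal (f x powr p * w x) + ennreal \<beta> * ennreal (w x) \<partial>M)"
  proof (intro nn_integral_mono)
    fix x
    have "f x * w x \<le> (\<alpha> * f x powr p + \<beta>) * w x"
      using powr_weighted_young[OF nonneg(1) t(1) p, of x] nonneg
      by (intro mult_right_mono) (auto simp: \<alpha>_def \<beta>_def)
    then show "ennreal (f x * w x) \<le> ennreal \<alpha> * ennreal (f x powr p * w x) + ennreal \<beta> * ennreal (w x)"
      using ab nonneg by (simp add: ennreal_mult[symmetric] ennreal_plus[symmetric] algebra_simps
          del: ennreal_plus)
  qed
  also have "\<dots> = ennreal \<alpha> * ennreal F + ennreal \<beta> * ennreal W"
    using F W by (simp add: nn_integral_add nn_integral_cmult)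
  also have "\<dots> = ennreal (\<alpha> * F + \<beta> * W)"
    using ab F W by (simp add: ennreal_mult)
  also have "\<alpha> * F + \<beta> * W = t * W"
  proof -
    have "t powr (1 - p) * F = t powr (1 - p) * t powr p * W"
      using t W by simp
    also have "\<dots> = t * W"
      unfolding powr_add[symmetric] using t by simp
    finally show ?thesis
      using p by (simp add: \<alpha>_def \<beta>_def field_simps)
  qed
  finally have le: "(\<integral>\<^sup>+x. ennreal (f x * w x) \<partial>M) \<le> ennreal (t * W)" .
  then obtain I where I: "(\<integral>\<^sup>+x. ennreal (f x * w x) \<partial>M) = ennreal I" "0 \<le> I"
    by (metis ennreal_cases ennreal_less_top leD top.extremum_strict order.strict_trans2 less_le_not_le)
  then have "I \<le> t * W"
    using le t W by (simp add: ennreal_le_iff)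
  then have "I powr p \<le> (t * W) powr p"
    using I p by (intro powr_mono2) auto
  also have "\<dots> = F / W * W powr p"
    using t W by (simp add: powr_mult)
  also have "\<dots> = W powr (p - 1) * F"
    using W by (simp add: powr_diff)
  finally show ?thesis
    using that I by blast
qed

lemma AE_lebesgue_affine:
  fixes A :: "real ^ 'n ^ 'n"
  assumes "det A \<noteq> 0" "AE x in lebesgue. P x"
  shows "AE x in lebesgue. P (A *v x - c)"
proof -
  have "AE x in distr lebesgue lebesgue (\<lambda>x. A *v x - c). P x"
    using assms by (subst (asm) lebesgue_affine_matrix(1)[OF assms(1), of c]) (simp add: AE_density)
  then show ?thesis
    by (rule AE_distrD[OF lebesgue_affine_matrix(2)[OF assms(1)]])
qed

lemma nn_integral_infsum:
  fixes f :: "'i \<Rightarrow> 'a \<Rightarrow> ennreal"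
  assumes "countable A" "\<And>i. i \<in> A \<Longrightarrow> f i \<in> borel_measurable M"
  shows "(\<integral>\<^sup>+x. (\<Sum>\<^sub>\<infinity>i\<in>A. f i x) \<partial>M) = (\<Sum>\<^sub>\<infinity>i\<in>A. \<integral>\<^sup>+x. f i x \<partial>M)"
  using assms by (simp add: infsum_eq_nn_integral_count_space nn_integral_count_space_nn_integral)

lemma infsum_ennreal_mono:
  fixes f g :: "'a \<Rightarrow> ennreal"
  assumes "\<And>x. x \<in> A \<Longrightarrow> f x \<le> g x"
  shows "infsum f A \<le> infsum g A"
  using assms by (intro infsum_mono nonneg_summable_on_complete) auto

lemma le_infsum_ennreal:
  fixes f :: "'a \<Rightarrow> ennreal"
  assumes "x \<in> A"
  shows "f x \<le> infsum f A"
  unfolding infsum_ennreal_eq_SUP using assms by (intro SUP_upper2[of "{x}"]) auto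

lemma borel_measurable_cnj [measurable]: "cnj \<in> borel_measurable borel"
  by (intro borel_measurable_continuous_onI continuous_intros)

text \<open>The constant is free of \<open>j\<close> since the powers of \<open>D\<close> cancel:
  the normalization contributes \<open>D powr (p - 1)\<close> to the \<open>p\<close>-th power,
  while each dilated weight \<open>w k\<close> has mass \<open>W / D\<close>, which Jensen's
  inequality raises to the power \<open>p - 1\<close>. Integrability is recorded because additivity
  of \<open>pairing\<close> in \<open>f\<close> depends on it.\<close>

lemma analysis_coefficients_bound:
  fixes a :: "nat \<Rightarrow> real ^ 'd ^ 'd" and \<phi> f :: "real ^ 'd \<Rightarrow> complex"
  assumes det: "det (a j) \<noteq> 0" and p: "1 \<le> p" and q: "enn2real (1 / q) = 1 - 1 / p"
    and [measurable]: "\<phi> \<in> borel_measurable lebesgue" "f \<in> borel_measurable lebesgue"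
    and W: "(\<integral>\<^sup>+x. ennreal (norm (\<phi> x)) \<partial>lebesgue) = ennreal W" "0 < W"
    and M: "AE x in lebesgue. (\<Sum>\<^sub>\<infinity>k\<in>UNIV. ennreal (norm (\<phi> (x - b *v vec_of_int k)))) \<le> ennreal M" "0 \<le> M"
    and f: "(\<integral>\<^sup>+x. ennreal (norm (f x) powr p) \<partial>lebesgue) < \<infinity>"
  shows "integrable lebesgue (\<lambda>x. f x * cnj (affine_system q a b \<phi> j k x))"
    and "(\<Sum>\<^sub>\<infinity>k\<in>UNIV. ennreal (norm (pairing f (affine_system q a b \<phi> j k)) powr p))
      \<le> ennreal (W powr (p - 1) * M) * (\<integral>\<^sup>+x. ennreal (norm (f x) powr p) \<partial>lebesgue)"
proof -
  define D where "D = \<bar>det (a j)\<bar>"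
  define w where "w = (\<lambda>k x. norm (\<phi> (a j *v x - b *v vec_of_int k)))"
  define F where "F = (\<lambda>k. \<integral>\<^sup>+x. ennreal (norm (f x) powr p * w k x) \<partial>lebesgue)"
  have D: "D > 0" using det by (simp add: D_def)
  have [measurable]: "(\<lambda>x. \<phi> (a j *v x - c)) \<in> borel_measurable lebesgue" for c
    by (rule borel_measurable_lebesgue_affine[OF det]) simp
  have [measurable]: "w k \<in> borel_measurable lebesgue" for k
    unfolding w_def by measurable
  have sumw: "AE x in lebesgue. (\<Sum>\<^sub>\<infinity>k\<in>UNIV. ennreal (w k x)) \<le> ennreal M"
    using AE_lebesgue_affine[OF det M(1), of 0] by (simp add: w_def)
  \<comment> \<open>\<open>F k\<close> is what Jensen's inequality leaves of the \<open>k\<close>-th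
    coefficient. Summing inside the integral brings in the sum of all weights, where the a.e. bound
    \<open>M\<close> applies.\<close>
  have "(\<Sum>\<^sub>\<infinity>k\<in>UNIV. F k) = (\<integral>\<^sup>+x. (\<Sum>\<^sub>\<infinity>k\<in>UNIV. ennreal (norm (f x) powr p * w k x)) \<partial>lebesgue)"
    unfolding F_def by (rule nn_integral_infsum[symmetric]) auto
  also have "\<dots> = (\<integral>\<^sup>+x. ennreal (norm (f x) powr p) * (\<Sum>\<^sub>\<infinity>k\<in>UNIV. ennreal (w k x)) \<partial>lebesgue)"
    by (simp add: ennreal_mult w_def infsum_cmult_ennreal)
  also have "\<dots> \<le> (\<integral>\<^sup>+x. ennreal (norm (f x) powr p) * ennreal M \<partial>lebesgue)"
    using sumw by (intro nn_integral_mono_AE) (auto elim!: eventually_mono intro: mult_left_mono)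
  also have "\<dots> = ennreal M * (\<integral>\<^sup>+x. ennreal (norm (f x) powr p) \<partial>lebesgue)"
    by (subst nn_integral_multc) (auto simp: mult.commute)
  finally have sumF: "(\<Sum>\<^sub>\<infinity>k\<in>UNIV. F k) \<le> ennreal M * (\<integral>\<^sup>+x. ennreal (norm (f x) powr p) \<partial>lebesgue)" .
  have coeff: "integrable lebesgue (\<lambda>x. f x * cnj (affine_system q a b \<phi> j k x)) \<and>
    ennreal (norm (pairing f (affine_system q a b \<phi> j k)) powr p) \<le> ennreal (W powr (p - 1)) * F k" for k
  proof -
    have "F k \<le> (\<Sum>\<^sub>\<infinity>k\<in>UNIV. F k)"
      by (rule le_infsum_ennreal) simp
    with sumF f have "F k < \<infinity>"
      by (metis ennreal_mult_less_top ennreal_less_top infinity_ennreal_def order_le_less_trans)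
    then obtain G where G: "F k = ennreal G" "0 \<le> G"
      by (metis ennreal_cases infinity_ennreal_def less_irrefl)
    have "ennreal W = ennreal D * (\<integral>\<^sup>+x. ennreal (w k x) \<partial>lebesgue)"
      unfolding W(1)[symmetric] w_def D_def
      by (rule nn_integral_lebesgue_affine[OF det]) simp
    then have Wk: "(\<integral>\<^sup>+x. ennreal (w k x) \<partial>lebesgue) = ennreal (W / D)"
      using D W
      by (metis divide_ennreal ennreal_mult_divide_eq ennreal_neq_top ennreal_eq_0_iff less_eq_real_def
          mult.commute not_less)
    obtain I where I: "(\<integral>\<^sup>+x. ennreal (norm (f x) * w k x) \<partial>lebesgue) = ennreal I" "0 \<le> I"
      "I powr p \<le> (W / D) powr (p - 1) * G"
      using nn_integral_weighted_jensen[of "\<lambda>x. norm (f x)" lebesgue "w k" p "W / D" G] Wk G W D p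
      unfolding F_def by (auto simp: w_def)
    have nrm: "norm (f x * cnj (affine_system q a b \<phi> j k x)) = D powr (1 - 1 / p) * (norm (f x) * w k x)" for x
      by (simp add: affine_system_def norm_mult w_def D_def q)
    have int: "(\<integral>\<^sup>+x. ennreal (norm (f x * cnj (affine_system q a b \<phi> j k x))) \<partial>lebesgue)
        = ennreal (D powr (1 - 1 / p) * I)"
      unfolding nrm using I by (simp add: ennreal_mult w_def nn_integral_cmult)
    have meas: "(\<lambda>x. f x * cnj (affine_system q a b \<phi> j k x)) \<in> borel_measurable lebesgue"
      unfolding affine_system_def by measurable
    have integrable: "integrable lebesgue (\<lambda>x. f x * cnj (affine_system q a b \<phi> j k x))"
      unfolding integrable_iff_bounded using int meas by simp
    have "ennreal (norm (pairing f (affine_system q a b \<phi> j k))) \<le> ennreal (D powr (1 - 1 / p) * I)"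
      unfolding pairing_def int[symmetric] by (rule integral_norm_bound_ennreal[OF integrable])
    then have "norm (pairing f (affine_system q a b \<phi> j k)) \<le> D powr (1 - 1 / p) * I"
      using I by (simp add: ennreal_le_iff)
    then have "norm (pairing f (affine_system q a b \<phi> j k)) powr p \<le> (D powr (1 - 1 / p) * I) powr p"
      using p by (intro powr_mono2) auto
    also have "\<dots> = D powr (p - 1) * I powr p"
      using D I p by (simp add: powr_mult powr_powr left_diff_distrib)
    also have "\<dots> \<le> D powr (p - 1) * ((W / D) powr (p - 1) * G)"
      using I by (intro mult_left_mono) auto
    also have "\<dots> = W powr (p - 1) * G"
      using D W by (simp add: powr_divide)
    finally show ?thesis
      using integrable G by (simp add: ennreal_mult[symmetric])
  qed
  show "integrable lebesgue (\<lambda>x. f x * cnj (affine_system q a b \<phi> j k x))"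
    using coeff by blast
  have "(\<Sum>\<^sub>\<infinity>k\<in>UNIV. ennreal (norm (pairing f (affine_system q a b \<phi> j k)) powr p))
      \<le> (\<Sum>\<^sub>\<infinity>k\<in>UNIV. ennreal (W powr (p - 1)) * F k)"
    using coeff by (intro infsum_ennreal_mono) blast
  also have "\<dots> = ennreal (W powr (p - 1)) * (\<Sum>\<^sub>\<infinity>k\<in>UNIV. F k)"
    by (rule infsum_cmult_ennreal) simp
  also have "\<dots> \<le> ennreal (W powr (p - 1)) * (ennreal M * (\<integral>\<^sup>+x. ennreal (norm (f x) powr p) \<partial>lebesgue))"
    using sumF by (rule mult_left_mono) simp
  finally show "(\<Sum>\<^sub>\<infinity>k\<in>UNIV. ennreal (norm (pairing f (affine_system q a b \<phi> j k)) powr p))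
      \<le> ennreal (W powr (p - 1) * M) * (\<integral>\<^sup>+x. ennreal (norm (f x) powr p) \<partial>lebesgue)"
    using M(2) by (simp add: ennreal_mult mult.assoc)
qed

section \<open>The lower bound for bounded continuous functions\<close>

text \<open>The cubes \<open>k + [0,1)^d\<close> partition the space, so superposing their indicator
  functions with coefficients \<open>c k\<close> amounts to the composition of \<open>c\<close> with
  \<open>lattice_cell\<close>. Synthesis is thus a composition and not a series.\<close>

definition lattice_cell :: "real ^ 'n \<Rightarrow> int ^ 'n"
  where "lattice_cell y = (\<chi> i. \<lfloor>y $ i\<rfloor>)"

lemma lattice_cell_eq_iff:
  "lattice_cell y = k \<longleftrightarrow> (\<forall>i. real_of_int (k $ i) \<le> y $ i \<and> y $ i < real_of_int (k $ i) + 1)"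
  by (auto simp: lattice_cell_def vec_eq_iff floor_eq_iff)

lemma norm_lattice_cell_diff_le:
  fixes y :: "real ^ 'n"
  shows "norm (y - vec_of_int (lattice_cell y)) \<le> real CARD('n)"
proof -
  have "norm (y - vec_of_int (lattice_cell y)) \<le> (\<Sum>i\<in>UNIV. \<bar>(y - vec_of_int (lattice_cell y)) $ i\<bar>)"
    by (rule norm_le_l1_cart)
  also have "\<dots> \<le> (\<Sum>i\<in>(UNIV :: 'n set). 1)"
    by (intro sum_mono) (simp add: lattice_cell_def vec_of_int_def abs_le_iff; linarith)
  finally show ?thesis by simp
qed

lemma measurable_lattice_cell [measurable]:
  "lattice_cell \<in> borel \<rightarrow>\<^sub>M count_space (UNIV :: (int ^ 'n) set)"
proof -
  have "lattice_cell -` {k} \<in> sets (borel :: (real ^ 'n) measure)" for k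
  proof -
    have "lattice_cell -` {k} =
        {y :: real ^ 'n. \<forall>i. real_of_int (k $ i) \<le> y $ i \<and> y $ i < real_of_int (k $ i) + 1}"
      by (simp add: vimage_def lattice_cell_eq_iff)
    also have "\<dots> \<in> sets borel"
      by measurable
    finally show ?thesis .
  qed
  then show ?thesis
    by (subst measurable_count_space_eq2_countable) auto
qed

lemma emeasure_lattice_cell:
  "emeasure lebesgue {y :: real ^ 'n. lattice_cell y = k} = 1"
proof (rule antisym)
  let ?u = "\<chi> i. real_of_int (k $ i) + 1"
  have [measurable]: "{y. lattice_cell y = k} \<in> sets borel"
    using measurable_sets[OF measurable_lattice_cell, of "{k}"] by (simp add: vimage_def)
  have "{y. lattice_cell y = k} \<subseteq> cbox (vec_of_int k) ?u"
    by (auto simp: lattice_cell_eq_iff mem_box_cart vec_of_int_def less_imp_le)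
  then have "emeasure lebesgue {y. lattice_cell y = k} \<le> emeasure lebesgue (cbox (vec_of_int k) ?u)"
    by (intro emeasure_mono) auto
  also have "\<dots> = 1"
    by (simp add: emeasure_lborel_cbox_eq Basis_vec_def prod.UNION_disjoint axis_eq_axis inner_axis
        vec_of_int_def)
  finally show "emeasure lebesgue {y. lattice_cell y = k} \<le> 1" .
  have "1 = emeasure lebesgue (box (vec_of_int k) ?u)"
    by (simp add: emeasure_lborel_box_eq Basis_vec_def prod.UNION_disjoint axis_eq_axis inner_axis
        vec_of_int_def)
  also have "box (vec_of_int k) ?u \<subseteq> {y. lattice_cell y = k}"
    by (auto simp: lattice_cell_eq_iff mem_box_cart vec_of_int_def less_imp_le)
  then have "emeasure lebesgue (box (vec_of_int k) ?u) \<le> emeasure lebesgue {y. lattice_cell y = k}"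
    by (intro emeasure_mono) auto
  finally show "1 \<le> emeasure lebesgue {y. lattice_cell y = k}" .
qed

text \<open>The cells partition the space and each has measure 1. This makes synthesis an isometry
  and turns coefficient sums into integrals to which Fatou's lemma applies.\<close>

lemma nn_integral_lattice_cell:
  fixes H :: "int ^ 'n \<Rightarrow> ennreal"
  shows "(\<integral>\<^sup>+y. H (lattice_cell y) \<partial>lebesgue) = (\<Sum>\<^sub>\<infinity>k\<in>UNIV. H k)"
proof -
  have [measurable]: "{y. lattice_cell y = k} \<in> sets lebesgue" for k :: "int ^ 'n"
    using measurable_sets[OF measurable_lattice_cell, of "{k}"] by (simp add: vimage_def)
  have "H (lattice_cell y) = (\<Sum>\<^sub>\<infinity>k\<in>UNIV. H k * indicator {y. lattice_cell y = k} y)" for y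
    using nn_integral_count_space'[of "{lattice_cell y}" UNIV "\<lambda>k. H k * indicator {y. lattice_cell y = k} y"]
    by (simp add: infsum_eq_nn_integral_count_space indicator_def)
  then have "(\<integral>\<^sup>+y. H (lattice_cell y) \<partial>lebesgue)
      = (\<integral>\<^sup>+y. (\<Sum>\<^sub>\<infinity>k\<in>UNIV. H k * indicator {y. lattice_cell y = k} y) \<partial>lebesgue)"
    by simp
  also have "\<dots> = (\<Sum>\<^sub>\<infinity>k\<in>UNIV. \<integral>\<^sup>+y. H k * indicator {y. lattice_cell y = k} y \<partial>lebesgue)"
    by (rule nn_integral_infsum) auto
  also have "\<dots> = (\<Sum>\<^sub>\<infinity>k\<in>UNIV. H k)"
    by (simp add: nn_integral_cmult_indicator emeasure_lattice_cell)
  finally show ?thesis .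
qed

lemma matrix_inv_inverse:
  assumes "invertible A"
  shows "A ** matrix_inv A = mat 1" "matrix_inv A ** A = mat 1"
  using someI_ex[OF assms[unfolded invertible_def]] by (auto simp: matrix_inv_def)

text \<open>With \<open>B = b\<^sup>-\<^sup>1 A\<close>, the function \<open>x \<mapsto> dilated_average A b \<phi> g (lattice_cell (B x))\<close> is the
  synthesis, with the indicator function of \<open>b[0,1)\<^sup>d\<close>, of the coefficients of \<open>g\<close> at scale \<open>A\<close>.\<close>

definition dilated_average ::
    "real ^ 'n ^ 'n \<Rightarrow> real ^ 'n ^ 'n \<Rightarrow> (real ^ 'n \<Rightarrow> complex) \<Rightarrow> (real ^ 'n \<Rightarrow> complex) \<Rightarrow> int ^ 'n \<Rightarrow> complex"
  where "dilated_average A b \<phi> g k =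
    (\<integral>y. g (matrix_inv A *v (y + b *v vec_of_int k)) * cnj (\<phi> y) \<partial>lebesgue)"

text \<open>The substitution \<open>y = a j *v x - b *v vec_of_int k\<close> divides by
  \<open>D = \<bar>det (a j)\<bar>\<close>; with the normalization this leaves
  \<open>D powr (- (1 / p))\<close>, hence \<open>1 / D\<close> after taking \<open>p\<close>-th
  powers.\<close>

lemma norm_pairing_eq_dilated_average:
  fixes a :: "nat \<Rightarrow> real ^ 'd ^ 'd"
  assumes inv: "invertible (a j)" and p: "1 \<le> p" and q: "enn2real (1 / q) = 1 - 1 / p"
    and [measurable]: "\<phi> \<in> borel_measurable lebesgue" "g \<in> borel_measurable borel"
  shows "norm (pairing g (affine_system q a b \<phi> j k)) powr p
    = norm (dilated_average (a j) b \<phi> g k) powr p / \<bar>det (a j)\<bar>"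
proof -
  define D where "D = \<bar>det (a j)\<bar>"
  have det: "det (a j) \<noteq> 0" using inv by (simp add: invertible_det_nz)
  then have D: "D > 0" by (simp add: D_def)
  define c where "c = b *v vec_of_int k"
  define h where "h y = g (matrix_inv (a j) *v (y + c)) * cnj (\<phi> y)" for y
  have "(\<lambda>y. g (matrix_inv (a j) *v (y + c))) \<in> borel_measurable borel"
    by measurable
  then have [measurable]: "(\<lambda>y. g (matrix_inv (a j) *v (y + c))) \<in> borel_measurable lebesgue"
    by (intro measurable_completion) simp
  then have "h \<in> borel_measurable lebesgue"
    unfolding h_def by measurable
  then have "(\<integral>y. h y \<partial>lebesgue) = D *\<^sub>R (\<integral>x. h (a j *v x - c) \<partial>lebesgue)"
    unfolding D_def by (rule integral_lebesgue_affine[OF det])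
  moreover have "(\<lambda>x. h (a j *v x - c)) = (\<lambda>x. g x * cnj (\<phi> (a j *v x - c)))"
    using inv by (simp add: h_def matrix_vector_mul_assoc matrix_inv_inverse)
  moreover have "dilated_average (a j) b \<phi> g k = (\<integral>y. h y \<partial>lebesgue)"
    by (simp add: dilated_average_def h_def c_def)
  ultimately have "(\<integral>x. g x * cnj (\<phi> (a j *v x - c)) \<partial>lebesgue) = dilated_average (a j) b \<phi> g k /\<^sub>R D"
    using D by simp
  moreover have "pairing g (affine_system q a b \<phi> j k)
      = complex_of_real (D powr (1 - 1 / p)) * (\<integral>x. g x * cnj (\<phi> (a j *v x - c)) \<partial>lebesgue)"
    unfolding pairing_def affine_system_def integral_mult_right_zero[symmetric]
    by (simp add: q D_def c_def mult_ac)
  ultimately have "norm (pairing g (affine_system q a b \<phi> j k))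
      = D powr (1 - 1 / p) * (norm (dilated_average (a j) b \<phi> g k) / D)"
    using D by (simp add: norm_mult divide_inverse mult.commute)
  also have "\<dots> = norm (dilated_average (a j) b \<phi> g k) * D powr (- (1 / p))"
    using D by (simp add: powr_diff powr_minus field_simps)
  finally have nrm: "norm (pairing g (affine_system q a b \<phi> j k))
      = norm (dilated_average (a j) b \<phi> g k) * D powr (- (1 / p))" .
  have "- (1 / p) * p = - 1"
    using p by simp
  then have "(D powr (- (1 / p))) powr p = 1 / D"
    unfolding powr_powr using D by (simp add: powr_minus divide_inverse)
  then show ?thesis
    unfolding nrm D_def[symmetric] by (simp add: powr_mult)
qed

text \<open>With \<open>z = (matrix_inv b ** a j) *v x\<close>, the point at which \<open>g\<close>
  is evaluated differs from \<open>x\<close> by \<open>matrix_inv (a j)\<close> applied to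
  \<open>y - b *v (z - vec_of_int (\<kappa> j))\<close>. The second term is bounded by
  \<open>R\<close>, uniformly in \<open>j\<close> and \<open>x\<close>, so the expanding property
  sends the difference to 0 for each \<open>y\<close>. Dominated convergence with majorant
  \<open>K * norm (\<phi> y)\<close> leaves \<open>g x\<close> times the conjugate of the integral
  of \<open>\<phi>\<close>, which is 1.\<close>

lemma dilated_average_tendsto:
  fixes a :: "nat \<Rightarrow> real ^ 'd ^ 'd" and b :: "real ^ 'd ^ 'd"
  assumes inv: "\<And>j. j > 0 \<Longrightarrow> invertible (a j)" and exp: "expanding a" and b: "invertible b"
    and \<phi>: "integrable lebesgue \<phi>" "(\<integral>x. \<phi> x \<partial>lebesgue) = 1"
    and g: "continuous_on UNIV g" "\<And>x. norm (g x) \<le> K"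
  shows "(\<lambda>j. dilated_average (a j) b \<phi> g (lattice_cell ((matrix_inv b ** a j) *v x))) \<longlonglongrightarrow> g x"
proof -
  define \<kappa> where "\<kappa> j = lattice_cell ((matrix_inv b ** a j) *v x)" for j
  define N where "N j = onorm (\<lambda>v. matrix_inv (a j) *v v)" for j
  define R where "R = onorm ((*v) b) * real CARD('d)"
  have N: "N \<longlonglongrightarrow> 0"
    using exp unfolding expanding_def N_def .
  have [measurable]: "g \<in> borel_measurable borel"
    using g(1) by (rule borel_measurable_continuous_onI)
  have [measurable]: "\<phi> \<in> borel_measurable lebesgue"
    using \<phi>(1) by simp
  have dist: "norm (matrix_inv (a j) *v (y + b *v vec_of_int (\<kappa> j)) - x) \<le> N j * (norm y + R)"
    if "j > 0" for j y
  proof -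
    define z where "z = (matrix_inv b ** a j) *v x"
    have bz: "b *v z = a j *v x"
      using matrix_inv_inverse[OF b] by (simp add: z_def matrix_vector_mul_assoc matrix_mul_assoc)
    have "norm (b *v (z - vec_of_int (\<kappa> j))) \<le> onorm ((*v) b) * norm (z - vec_of_int (\<kappa> j))"
      by (intro onorm matrix_vector_mul_bounded_linear)
    also have "\<dots> \<le> R"
      unfolding R_def \<kappa>_def z_def[symmetric]
      by (intro mult_left_mono norm_lattice_cell_diff_le onorm_pos_le matrix_vector_mul_bounded_linear)
    finally have R: "norm (b *v (z - vec_of_int (\<kappa> j))) \<le> R" .
    have x: "x = matrix_inv (a j) *v (a j *v x)"
      using matrix_inv_inverse[OF inv[OF that]] by (simp add: matrix_vector_mul_assoc)
    have "matrix_inv (a j) *v (y + b *v vec_of_int (\<kappa> j)) - x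
        = matrix_inv (a j) *v (y + b *v vec_of_int (\<kappa> j)) - matrix_inv (a j) *v (b *v z)"
      using x by (simp only: bz)
    also have "\<dots> = matrix_inv (a j) *v (y - b *v (z - vec_of_int (\<kappa> j)))"
      by (simp only: matrix_vector_mult_diff_distrib matrix_vector_right_distrib diff_diff_eq2)
    also have "norm \<dots> \<le> N j * norm (y - b *v (z - vec_of_int (\<kappa> j)))"
      unfolding N_def by (intro onorm matrix_vector_mul_bounded_linear)
    also have "\<dots> \<le> N j * (norm y + R)"
      using R norm_triangle_ineq4[of y "b *v (z - vec_of_int (\<kappa> j))"] unfolding N_def
      by (intro mult_left_mono onorm_pos_le matrix_vector_mul_bounded_linear) auto
    finally show ?thesis .
  qed
  have lim: "(\<lambda>j. matrix_inv (a j) *v (y + b *v vec_of_int (\<kappa> j))) \<longlonglongrightarrow> x" for y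
  proof (rule Lim_null[THEN iffD2], rule Lim_null_comparison)
    show "\<forall>\<^sub>F j in sequentially. norm (matrix_inv (a j) *v (y + b *v vec_of_int (\<kappa> j)) - x) \<le> N j * (norm y + R)"
      using eventually_gt_at_top[of 0] by eventually_elim (rule dist)
    show "(\<lambda>j. N j * (norm y + R)) \<longlonglongrightarrow> 0"
      using tendsto_mult_right[OF N, of "norm y + R"] by simp
  qed
  have "(\<lambda>j. \<integral>y. g (matrix_inv (a j) *v (y + b *v vec_of_int (\<kappa> j))) * cnj (\<phi> y) \<partial>lebesgue)
      \<longlonglongrightarrow> (\<integral>y. g x * cnj (\<phi> y) \<partial>lebesgue)"
  proof (rule integral_dominated_convergence[where w = "\<lambda>y. K * norm (\<phi> y)"])
    show "integrable lebesgue (\<lambda>y. K * norm (\<phi> y))"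
      using \<phi>(1) by (intro integrable_mult_right integrable_norm)
    show "AE y in lebesgue. (\<lambda>j. g (matrix_inv (a j) *v (y + b *v vec_of_int (\<kappa> j))) * cnj (\<phi> y))
        \<longlonglongrightarrow> g x * cnj (\<phi> y)"
      using g(1) lim
      by (intro AE_I2 tendsto_mult_right continuous_on_tendsto_compose[of UNIV g]) auto
    show "AE y in lebesgue. norm (g (matrix_inv (a j) *v (y + b *v vec_of_int (\<kappa> j))) * cnj (\<phi> y)) \<le> K * norm (\<phi> y)" for j
      using g(2) by (intro AE_I2) (simp add: norm_mult mult_right_mono)
    have "(\<lambda>y. g (matrix_inv (a j) *v (y + b *v vec_of_int (\<kappa> j)))) \<in> borel_measurable lebesgue" for j
      by (intro measurable_completion) simp
    then show "(\<lambda>y. g (matrix_inv (a j) *v (y + b *v vec_of_int (\<kappa> j))) * cnj (\<phi> y)) \<in> borel_measurable lebesgue" for j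
      by measurable
  qed simp
  also have "(\<integral>y. g x * cnj (\<phi> y) \<partial>lebesgue) = g x * cnj (\<integral>y. \<phi> y \<partial>lebesgue)"
    by simp
  finally show ?thesis
    using \<phi>(2) by (simp add: dilated_average_def \<kappa>_def)
qed

text \<open>The integral of the synthesized function is exactly
  \<open>\<bar>det b\<bar> * T j\<close> at every scale: the factor
  \<open>1 / \<bar>det (a j)\<bar>\<close> of the coefficients meets \<open>\<bar>det (B j)\<bar> =
  \<bar>det (a j)\<bar> / \<bar>det b\<bar>\<close> from the substitution by \<open>B j\<close>.
  Fatou's lemma works in [0, infinity], so both sides may be infinite.\<close>

lemma nn_integral_norm_powr_le_coefficients:
  fixes a :: "nat \<Rightarrow> real ^ 'd ^ 'd" and b :: "real ^ 'd ^ 'd"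
  assumes inv: "\<And>j. j > 0 \<Longrightarrow> invertible (a j)" and exp: "expanding a" and b: "invertible b"
    and p: "1 \<le> p" and q: "enn2real (1 / q) = 1 - 1 / p"
    and \<phi>: "integrable lebesgue \<phi>" "(\<integral>x. \<phi> x \<partial>lebesgue) = 1"
    and g: "continuous_on UNIV g" "\<And>x. norm (g x) \<le> K"
  shows "(\<integral>\<^sup>+x. ennreal (norm (g x) powr p) \<partial>lebesgue) \<le> ennreal \<bar>det b\<bar> *
    (SUP j\<in>{0<..}. \<Sum>\<^sub>\<infinity>k\<in>UNIV. ennreal (norm (pairing g (affine_system q a b \<phi> j k)) powr p))"
proof -
  define T where "T j = (\<Sum>\<^sub>\<infinity>k\<in>UNIV. ennreal (norm (pairing g (affine_system q a b \<phi> j k)) powr p))" for j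
  define B where "B j = matrix_inv b ** a j" for j
  define H where "H j k = ennreal (norm (dilated_average (a j) b \<phi> g k) powr p)" for j k
  have [measurable]: "g \<in> borel_measurable borel"
    using g(1) by (rule borel_measurable_continuous_onI)
  have [measurable]: "\<phi> \<in> borel_measurable lebesgue"
    using \<phi>(1) by simp
  have "det b * det (matrix_inv b) = 1"
    using matrix_inv_inverse(1)[OF b] by (metis det_I det_mul)
  then have detb: "det b \<noteq> 0" "det (matrix_inv b) = 1 / det b"
    by (auto simp: eq_divide_eq mult.commute)
  have meas: "(\<lambda>y. H j (lattice_cell y)) \<in> borel_measurable borel" for j
    by measurable
  have eq: "(\<integral>\<^sup>+x. H j (lattice_cell (B j *v x)) \<partial>lebesgue) = ennreal \<bar>det b\<bar> * T j" if "j > 0" for j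
  proof -
    have deta: "det (a j) \<noteq> 0"
      using inv[OF that] by (simp add: invertible_det_nz)
    then have detB: "det (B j) \<noteq> 0" "\<bar>det (B j)\<bar> = \<bar>det (a j)\<bar> / \<bar>det b\<bar>"
      using detb by (auto simp: B_def det_mul abs_mult)
    have "T j = (\<Sum>\<^sub>\<infinity>k\<in>UNIV. ennreal (1 / \<bar>det (a j)\<bar>) * H j k)"
      unfolding T_def H_def norm_pairing_eq_dilated_average[where a = a, OF inv[OF that] p q \<open>\<phi> \<in> _\<close> \<open>g \<in> _\<close>]
      by (simp add: ennreal_mult[symmetric])
    also have "\<dots> = ennreal (1 / \<bar>det (a j)\<bar>) * (\<Sum>\<^sub>\<infinity>k\<in>UNIV. H j k)"
      by (rule infsum_cmult_ennreal) simp
    also have "(\<Sum>\<^sub>\<infinity>k\<in>UNIV. H j k) = (\<integral>\<^sup>+y. H j (lattice_cell y) \<partial>lebesgue)"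
      by (rule nn_integral_lattice_cell[symmetric])
    also have "\<dots> = ennreal \<bar>det (B j)\<bar> * (\<integral>\<^sup>+x. H j (lattice_cell (B j *v x)) \<partial>lebesgue)"
      using nn_integral_lebesgue_affine[OF detB(1), of "\<lambda>y. H j (lattice_cell y)" 0] meas
      by (simp add: measurable_completion)
    finally have "ennreal \<bar>det b\<bar> * T j = (ennreal \<bar>det b\<bar> * (ennreal (1 / \<bar>det (a j)\<bar>) * ennreal \<bar>det (B j)\<bar>))
        * (\<integral>\<^sup>+x. H j (lattice_cell (B j *v x)) \<partial>lebesgue)"
      by (simp add: mult_ac)
    also have "ennreal \<bar>det b\<bar> * (ennreal (1 / \<bar>det (a j)\<bar>) * ennreal \<bar>det (B j)\<bar>) = 1"
      using deta detb by (simp add: detB ennreal_mult[symmetric])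
    finally show ?thesis by simp
  qed
  \<comment> \<open>The shift by \<open>Suc\<close> skips scale 0, where \<open>a\<close> need not
    be invertible and which the supremum over \<open>{0<..}\<close> leaves out.\<close>
  have liminf: "liminf (\<lambda>n. H (Suc n) (lattice_cell (B (Suc n) *v x))) = ennreal (norm (g x) powr p)" for x
  proof (rule lim_imp_Liminf)
    have "(\<lambda>n. dilated_average (a (Suc n)) b \<phi> g (lattice_cell (B (Suc n) *v x))) \<longlonglongrightarrow> g x"
      using dilated_average_tendsto[OF inv exp b \<phi> g] unfolding B_def by (rule LIMSEQ_Suc)
    then show "(\<lambda>n. H (Suc n) (lattice_cell (B (Suc n) *v x))) \<longlonglongrightarrow> ennreal (norm (g x) powr p)"
      unfolding H_def using p by (intro tendsto_ennrealI tendsto_powr' tendsto_norm tendsto_const) auto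
  qed simp
  have "(\<integral>\<^sup>+x. ennreal (norm (g x) powr p) \<partial>lebesgue)
      = (\<integral>\<^sup>+x. liminf (\<lambda>n. H (Suc n) (lattice_cell (B (Suc n) *v x))) \<partial>lebesgue)"
    by (simp add: liminf)
  also have "\<dots> \<le> liminf (\<lambda>n. \<integral>\<^sup>+x. H (Suc n) (lattice_cell (B (Suc n) *v x)) \<partial>lebesgue)"
  proof (rule nn_integral_liminf)
    have "(\<lambda>x. H (Suc n) (lattice_cell (B (Suc n) *v x))) \<in> borel_measurable borel" for n
      using meas by (rule measurable_compose[rotated]) measurable
    then show "(\<lambda>x. H (Suc n) (lattice_cell (B (Suc n) *v x))) \<in> borel_measurable lebesgue" for n
      by (intro measurable_completion) simp
  qed
  also have "\<dots> = liminf (\<lambda>n. ennreal \<bar>det b\<bar> * T (Suc n))"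
    by (simp add: eq)
  also have "\<dots> \<le> ennreal \<bar>det b\<bar> * (SUP j\<in>{0<..}. T j)"
    by (intro Liminf_le always_eventually allI mult_left_mono SUP_upper) auto
  finally show ?thesis
    unfolding T_def .
qed

section \<open>Density of the bounded continuous functions\<close>

lemma norm_add_powr_le:
  fixes x y :: "'a::real_normed_vector"
  assumes "0 \<le> p"
  shows "norm (x + y) powr p \<le> 2 powr p * (norm x powr p + norm y powr p)"
proof -
  define m where "m = max (norm x) (norm y)"
  have "norm (x + y) \<le> 2 * m"
    using norm_triangle_ineq[of x y] by (auto simp: m_def)
  then have "norm (x + y) powr p \<le> (2 * m) powr p"
    using assms by (intro powr_mono2) auto
  also have "\<dots> = 2 powr p * m powr p"
    by (simp add: powr_mult m_def)
  also have "m powr p \<le> norm x powr p + norm y powr p"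
    by (auto simp: m_def max_def)
  finally show ?thesis by simp
qed

lemma nn_integral_norm_add_powr_le:
  fixes f g :: "'a \<Rightarrow> complex"
  assumes "0 \<le> p" and [measurable]: "f \<in> borel_measurable M" "g \<in> borel_measurable M"
  shows "(\<integral>\<^sup>+x. ennreal (norm (f x + g x) powr p) \<partial>M) \<le> ennreal (2 powr p) *
    ((\<integral>\<^sup>+x. ennreal (norm (f x) powr p) \<partial>M) + (\<integral>\<^sup>+x. ennreal (norm (g x) powr p) \<partial>M))"
proof -
  have "(\<integral>\<^sup>+x. ennreal (norm (f x + g x) powr p) \<partial>M)
      \<le> (\<integral>\<^sup>+x. ennreal (2 powr p) * (ennreal (norm (f x) powr p) + ennreal (norm (g x) powr p)) \<partial>M)"
    using norm_add_powr_le[OF assms(1)]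
    by (intro nn_integral_mono) (simp add: ennreal_mult[symmetric] ennreal_plus[symmetric] del: ennreal_plus)
  then show ?thesis
    by (simp add: nn_integral_cmult nn_integral_add)
qed

text \<open>The first factor is a continuous cutoff in space, equal to 1 for
  \<open>norm x \<le> N\<close> and to 0 for \<open>norm x \<ge> N + 1\<close>; the second retracts
  \<open>z\<close> radially onto the disc of radius \<open>N\<close>. For \<open>0 < N\<close> both
  are continuous, so truncation preserves continuous functions and commutes with pointwise
  limits.\<close>

definition truncation :: "real \<Rightarrow> 'a::real_normed_vector \<Rightarrow> complex \<Rightarrow> complex"
  where "truncation N x z =
    of_real (max 0 (min 1 (N + 1 - norm x)) * (N / max N (norm z))) * z"

lemma truncation_factor:
  assumes "0 < N"
  obtains c where "0 \<le> c" "c \<le> 1" "truncation N x z = of_real c * z"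
    "norm x \<le> N \<Longrightarrow> norm z \<le> N \<Longrightarrow> c = 1"
proof
  let ?c = "max 0 (min 1 (N + 1 - norm x)) * (N / max N (norm z))"
  show "0 \<le> ?c" "truncation N x z = of_real ?c * z" "norm x \<le> N \<Longrightarrow> norm z \<le> N \<Longrightarrow> ?c = 1"
    using assms by (auto simp: truncation_def)
  have "?c \<le> 1 * 1"
    using assms by (intro mult_mono) auto
  then show "?c \<le> 1" by simp
qed

lemma norm_truncation_le:
  assumes "0 < N"
  shows "norm (truncation N x z) \<le> N * indicator (cball 0 (N + 1)) x"
proof -
  have "norm (truncation N x z) = max 0 (min 1 (N + 1 - norm x)) * (N / max N (norm z) * norm z)"
    unfolding truncation_def norm_mult norm_of_real using assms by (simp add: abs_mult)
  also have "\<dots> \<le> indicator (cball 0 (N + 1)) x * N"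
    using assms by (intro mult_mono) (auto simp: indicator_def field_simps max_def)
  finally show ?thesis by (simp add: mult.commute)
qed

lemma continuous_on_truncation [continuous_intros]:
  assumes "0 < N" "continuous_on S f" "continuous_on S g"
  shows "continuous_on S (\<lambda>x. truncation N (f x) (g x))"
  unfolding truncation_def using assms by (intro continuous_intros) auto

lemma tendsto_truncation:
  assumes "0 < N" "(h \<longlongrightarrow> z) F"
  shows "((\<lambda>n. truncation N x (h n)) \<longlongrightarrow> truncation N x z) F"
  unfolding truncation_def using assms by (intro tendsto_intros) auto

lemma borel_measurable_truncation:
  fixes f :: "real ^ 'n \<Rightarrow> complex"
  assumes "0 < N" and [measurable]: "f \<in> borel_measurable lebesgue"
  shows "(\<lambda>x. truncation N x (f x)) \<in> borel_measurable lebesgue"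
proof -
  have [measurable]: "(\<lambda>x :: real ^ 'n. max 0 (min 1 (N + 1 - norm x))) \<in> borel_measurable lebesgue"
    by (intro measurable_completion) simp
  show ?thesis
    unfolding truncation_def by measurable
qed

text \<open>Dominated convergence with majorant \<open>norm (f x) powr p\<close>: the truncation
  factor lies between 0 and 1, and at each point it is exactly 1 from some \<open>n\<close>
  on.\<close>

lemma truncation_tendsto_Lp:
  fixes f :: "real ^ 'n \<Rightarrow> complex"
  assumes p: "0 < p" and [measurable]: "f \<in> borel_measurable lebesgue"
    and fin: "(\<integral>\<^sup>+x. ennreal (norm (f x) powr p) \<partial>lebesgue) < \<infinity>"
  shows "(\<lambda>n. \<integral>\<^sup>+x. ennreal (norm (f x - truncation (real (Suc n)) x (f x)) powr p) \<partial>lebesgue) \<longlonglongrightarrow> 0"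
proof -
  have [measurable]: "(\<lambda>x. truncation (real (Suc n)) x (f x)) \<in> borel_measurable lebesgue" for n
    by (intro borel_measurable_truncation) auto
  have "(\<lambda>n. \<integral>\<^sup>+x. ennreal (norm (f x - truncation (real (Suc n)) x (f x)) powr p) \<partial>lebesgue)
      \<longlonglongrightarrow> (\<integral>\<^sup>+x. 0 \<partial>(lebesgue :: (real ^ 'n) measure))"
  proof (rule nn_integral_dominated_convergence[OF _ _ _ _ fin])
    show "AE x in lebesgue. ennreal (norm (f x - truncation (real (Suc n)) x (f x)) powr p)
        \<le> ennreal (norm (f x) powr p)" for n
    proof (rule AE_I2)
      fix x
      obtain c where c: "0 \<le> c" "c \<le> 1" "truncation (real (Suc n)) x (f x) = of_real c * f x"
        by (rule truncation_factor[of "real (Suc n)" x "f x"]) auto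
      have "norm (f x - truncation (real (Suc n)) x (f x)) = norm (of_real (1 - c) * f x)"
        unfolding c(3) by (simp add: left_diff_distrib)
      also have "\<dots> \<le> 1 * norm (f x)"
        unfolding norm_mult norm_of_real using c by (intro mult_right_mono) auto
      finally show "ennreal (norm (f x - truncation (real (Suc n)) x (f x)) powr p)
          \<le> ennreal (norm (f x) powr p)"
        using p by (intro ennreal_leI powr_mono2) auto
    qed
    show "AE x in lebesgue. (\<lambda>n. ennreal (norm (f x - truncation (real (Suc n)) x (f x)) powr p)) \<longlonglongrightarrow> 0"
    proof (rule AE_I2)
      fix x
      obtain n0 where n0: "norm x \<le> real n0" "norm (f x) \<le> real n0"
        using real_arch_simple[of "max (norm x) (norm (f x))"] by auto
      have "truncation (real (Suc n)) x (f x) = f x" if "n \<ge> n0" for n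
      proof -
        obtain c where c: "truncation (real (Suc n)) x (f x) = of_real c * f x"
          "norm x \<le> real (Suc n) \<Longrightarrow> norm (f x) \<le> real (Suc n) \<Longrightarrow> c = 1"
          by (rule truncation_factor[of "real (Suc n)" x "f x"]) auto
        have "c = 1"
          using n0 that by (intro c(2)) auto
        then show ?thesis
          unfolding c(1) by simp
      qed
      then have "\<forall>\<^sub>F n in sequentially. ennreal (norm (f x - truncation (real (Suc n)) x (f x)) powr p) = 0"
        using p by (intro eventually_sequentiallyI[of n0]) simp
      then show "(\<lambda>n. ennreal (norm (f x - truncation (real (Suc n)) x (f x)) powr p)) \<longlonglongrightarrow> 0"
        by (rule tendsto_eventually)
    qed
    show "(\<lambda>x. ennreal (norm (f x - truncation (real (Suc n)) x (f x)) powr p)) \<in> borel_measurable lebesgue" for n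
      by measurable
  qed measurable
  then show ?thesis by simp
qed

text \<open>A Lebesgue measurable function is an a.e. limit of continuous functions
  \<open>h n\<close>, but these come without a common bound. Truncating them at the same level as
  \<open>f\<close> keeps the a.e. convergence and supplies the majorant
  \<open>(2 * N) powr p\<close> on a ball.\<close>

lemma continuous_approx_truncation:
  fixes f :: "real ^ 'n \<Rightarrow> complex"
  assumes p: "0 < p" and N: "0 < N" and [measurable]: "f \<in> borel_measurable lebesgue"
    and \<delta>: "0 < (\<delta> :: ennreal)"
  obtains g where "continuous_on UNIV g" "\<And>x. norm (g x) \<le> N"
    "(\<integral>\<^sup>+x. ennreal (norm (truncation N x (f x) - g x) powr p) \<partial>lebesgue) < \<delta>"
proof -
  have "f measurable_on UNIV"
    by (rule lebesgue_measurable_imp_measurable_on) auto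
  then obtain Z h where Z: "negligible Z" and h: "\<And>n. continuous_on UNIV (h n)"
    and lim: "\<And>x. x \<notin> Z \<Longrightarrow> (\<lambda>n. h n x) \<longlonglongrightarrow> f x"
    unfolding measurable_on_def by auto
  define G where "G n x = truncation N x (h n x)" for n and x :: "real ^ 'n"
  have G: "continuous_on UNIV (G n)" for n
    unfolding G_def using N h by (intro continuous_intros)
  then have [measurable]: "G n \<in> borel_measurable lebesgue" for n
    by (intro measurable_completion) (simp add: borel_measurable_continuous_onI)
  have [measurable]: "(\<lambda>x. truncation N x (f x)) \<in> borel_measurable lebesgue"
    using N by (intro borel_measurable_truncation) auto
  have bound: "norm (truncation N x (f x) - G n x) \<le> 2 * N * indicator (cball 0 (N + 1)) x" for n x
    using norm_triangle_ineq4[of "truncation N x (f x)" "G n x"]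
      norm_truncation_le[OF N, of x "f x"] norm_truncation_le[OF N, of x "h n x"]
    unfolding G_def by linarith
  have "(\<lambda>n. \<integral>\<^sup>+x. ennreal (norm (truncation N x (f x) - G n x) powr p) \<partial>lebesgue)
      \<longlonglongrightarrow> (\<integral>\<^sup>+x. 0 \<partial>(lebesgue :: (real ^ 'n) measure))"
  proof (rule nn_integral_dominated_convergence)
    let ?w = "\<lambda>x :: real ^ 'n. ennreal ((2 * N) powr p) * indicator (cball 0 (N + 1)) x"
    show "AE x in lebesgue. ennreal (norm (truncation N x (f x) - G n x) powr p) \<le> ?w x" for n
    proof (rule AE_I2)
      fix x
      have "norm (truncation N x (f x) - G n x) powr p \<le> (2 * N * indicator (cball 0 (N + 1)) x) powr p"
        using bound p by (intro powr_mono2) auto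
      then show "ennreal (norm (truncation N x (f x) - G n x) powr p) \<le> ?w x"
        using p by (auto simp: indicator_def ennreal_leI split: if_splits)
    qed
    have "emeasure lebesgue (cball (0 :: real ^ 'n) (N + 1)) < \<infinity>"
      using fmeasurableD2[OF lmeasurable_cball] by (simp add: less_top)
    then show "(\<integral>\<^sup>+x. ?w x \<partial>lebesgue) < \<infinity>"
      by (simp add: nn_integral_cmult_indicator ennreal_mult_less_top)
    have "AE x in lebesgue. x \<notin> Z"
      using Z by (simp add: negligible_iff_null_sets AE_not_in)
    then show "AE x in lebesgue. (\<lambda>n. ennreal (norm (truncation N x (f x) - G n x) powr p)) \<longlonglongrightarrow> 0"
    proof eventually_elim
      case (elim x)
      have "(\<lambda>n. norm (truncation N x (f x) - G n x) powr p) \<longlonglongrightarrow> norm (truncation N x (f x) - truncation N x (f x)) powr p"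
        unfolding G_def using lim[OF elim] N p
        by (intro tendsto_powr' tendsto_norm tendsto_diff tendsto_const tendsto_truncation) auto
      then have "(\<lambda>n. norm (truncation N x (f x) - G n x) powr p) \<longlonglongrightarrow> 0"
        using p by simp
      from tendsto_ennrealI[OF this] show ?case
        by simp
    qed
    show "(\<lambda>x. ennreal (norm (truncation N x (f x) - G n x) powr p)) \<in> borel_measurable lebesgue" for n
      by measurable
    have "cball (0 :: real ^ 'n) (N + 1) \<in> sets lebesgue"
      by simp
    then show "?w \<in> borel_measurable lebesgue"
      by (intro borel_measurable_times_ennreal borel_measurable_const borel_measurable_indicator)
  qed simp
  then have "\<forall>\<^sub>F n in sequentially. (\<integral>\<^sup>+x. ennreal (norm (truncation N x (f x) - G n x) powr p) \<partial>lebesgue) < \<delta>"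
    using \<delta> by (intro order_tendstoD(2)) auto
  then obtain n where "(\<integral>\<^sup>+x. ennreal (norm (truncation N x (f x) - G n x) powr p) \<partial>lebesgue) < \<delta>"
    using eventually_happens'[OF sequentially_bot] by blast
  moreover have "norm (G n x) \<le> N" for x
    using norm_truncation_le[OF N, of x "h n x"] N
    by (cases "norm x \<le> N + 1") (auto simp: G_def)
  ultimately show ?thesis
    using G that by blast
qed

lemma bounded_continuous_dense_Lp:
  fixes f :: "real ^ 'n \<Rightarrow> complex"
  assumes p: "0 < p" and [measurable]: "f \<in> borel_measurable lebesgue"
    and fin: "(\<integral>\<^sup>+x. ennreal (norm (f x) powr p) \<partial>lebesgue) < \<infinity>" and \<epsilon>: "0 < \<epsilon>"
  obtains g K where "continuous_on UNIV g" "\<And>x. norm (g x) \<le> K"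
    "(\<integral>\<^sup>+x. ennreal (norm (f x - g x) powr p) \<partial>lebesgue) \<le> ennreal \<epsilon>"
proof -
  define \<delta> where "\<delta> = \<epsilon> / (2 * 2 powr p)"
  have \<delta>: "\<delta> > 0" "2 powr p * (\<delta> + \<delta>) = \<epsilon>"
    using \<epsilon> by (auto simp: \<delta>_def)
  have "\<forall>\<^sub>F n in sequentially.
      (\<integral>\<^sup>+x. ennreal (norm (f x - truncation (real (Suc n)) x (f x)) powr p) \<partial>lebesgue) < ennreal \<delta>"
    using truncation_tendsto_Lp[OF p _ fin] \<delta> by (intro order_tendstoD(2)) auto
  then obtain n where n:
      "(\<integral>\<^sup>+x. ennreal (norm (f x - truncation (real (Suc n)) x (f x)) powr p) \<partial>lebesgue) < ennreal \<delta>"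
    using eventually_happens'[OF sequentially_bot] by blast
  define N where "N = real (Suc n)"
  have N: "N > 0" by (simp add: N_def)
  obtain g where g: "continuous_on UNIV g" "\<And>x. norm (g x) \<le> N"
    "(\<integral>\<^sup>+x. ennreal (norm (truncation N x (f x) - g x) powr p) \<partial>lebesgue) < ennreal \<delta>"
    using continuous_approx_truncation[OF p N, of f "ennreal \<delta>"] \<delta> by auto
  have [measurable]: "(\<lambda>x. truncation N x (f x)) \<in> borel_measurable lebesgue"
    using N by (intro borel_measurable_truncation) auto
  have [measurable]: "g \<in> borel_measurable lebesgue"
    using g(1) by (intro measurable_completion) (simp add: borel_measurable_continuous_onI)
  have "(\<integral>\<^sup>+x. ennreal (norm (f x - g x) powr p) \<partial>lebesgue)
      \<le> ennreal (2 powr p) * ((\<integral>\<^sup>+x. ennreal (norm (f x - truncation N x (f x)) powr p) \<partial>lebesgue)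
        + (\<integral>\<^sup>+x. ennreal (norm (truncation N x (f x) - g x) powr p) \<partial>lebesgue))"
    using nn_integral_norm_add_powr_le[of p "\<lambda>x. f x - truncation N x (f x)" lebesgue
        "\<lambda>x. truncation N x (f x) - g x"] p by simp
  also have "\<dots> \<le> ennreal (2 powr p) * (ennreal \<delta> + ennreal \<delta>)"
    using n g(3) unfolding N_def[symmetric] by (intro mult_left_mono add_mono) auto
  also have "\<dots> = ennreal \<epsilon>"
    using \<delta> by (simp add: ennreal_mult[symmetric] ennreal_plus[symmetric] del: ennreal_plus)
  finally show ?thesis
    using that g by blast
qed

section \<open>Norm equivalence\<close>

text \<open>One factor \<open>2 powr p\<close> comes from \<open>f = (f - g) + g\<close> in the
  function norm, the other from \<open>g = f + h\<close> in the coefficients. The upper bound enters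
  as a hypothesis for all functions because it is applied to the error \<open>h\<close> as well as
  to \<open>f\<close>.\<close>

lemma Lp_power_le_coefficients:
  fixes a :: "nat \<Rightarrow> real ^ 'd ^ 'd" and b :: "real ^ 'd ^ 'd"
    and p :: real and q :: ennreal and \<phi> :: "real ^ 'd \<Rightarrow> complex"
  defines "T \<equiv> \<lambda>f j. \<Sum>\<^sub>\<infinity>k\<in>UNIV. ennreal (norm (pairing f (affine_system q a b \<phi> j k)) powr p)"
  assumes inv: "\<And>j. j > 0 \<Longrightarrow> invertible (a j)" and exp: "expanding a" and b: "invertible b"
    and p: "1 \<le> p" and q: "enn2real (1 / q) = 1 - 1 / p"
    and \<phi>: "integrable lebesgue \<phi>" "(\<integral>x. \<phi> x \<partial>lebesgue) = 1"
    and C: "\<And>j f. j > 0 \<Longrightarrow> f \<in> borel_measurable lebesgue \<Longrightarrow>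
      (\<integral>\<^sup>+x. ennreal (norm (f x) powr p) \<partial>lebesgue) < \<infinity> \<Longrightarrow>
      (\<forall>k. integrable lebesgue (\<lambda>x. f x * cnj (affine_system q a b \<phi> j k x))) \<and>
      T f j \<le> ennreal C * (\<integral>\<^sup>+x. ennreal (norm (f x) powr p) \<partial>lebesgue)" "0 \<le> C"
    and f[measurable]: "f \<in> borel_measurable lebesgue"
    and fin: "(\<integral>\<^sup>+x. ennreal (norm (f x) powr p) \<partial>lebesgue) < \<infinity>"
  shows "(\<integral>\<^sup>+x. ennreal (norm (f x) powr p) \<partial>lebesgue)
    \<le> ennreal (2 powr p * \<bar>det b\<bar> * 2 powr p) * (SUP j\<in>{0<..}. T f j)"
proof (rule ennreal_le_epsilon)
  define S where "S = (SUP j\<in>{0<..}. T f j)"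
  \<comment> \<open>\<open>L * \<delta>\<close> is the total error:
    \<open>2 powr p * \<delta>\<close> from \<open>f - g\<close> directly, the rest from the
    coefficients of \<open>h\<close>, which are at most \<open>C * \<delta>\<close> in
    \<open>p\<close>-th power sum.\<close>
  define L where "L = 2 powr p * (\<bar>det b\<bar> * 2 powr p * C + 1)"
  have L: "L > 0"
    using C(2) by (simp add: L_def add_nonneg_pos)
  fix e :: real assume "e > 0"
  define \<delta> where "\<delta> = e / L"
  have \<delta>: "\<delta> > 0" "L * \<delta> = e"
    using \<open>e > 0\<close> L by (auto simp: \<delta>_def)
  have "0 < p" using p by simp
  then obtain g K where g: "continuous_on UNIV g" "\<And>x. norm (g x) \<le> K"
    and diff: "(\<integral>\<^sup>+x. ennreal (norm (f x - g x) powr p) \<partial>lebesgue) \<le> ennreal \<delta>"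
    using bounded_continuous_dense_Lp[OF _ f fin \<delta>(1)] by metis
  have [measurable]: "g \<in> borel_measurable lebesgue"
    using g(1) by (intro measurable_completion) (simp add: borel_measurable_continuous_onI)
  define h where "h x = g x - f x" for x
  have [measurable]: "h \<in> borel_measurable lebesgue"
    unfolding h_def by measurable
  have h: "(\<integral>\<^sup>+x. ennreal (norm (h x) powr p) \<partial>lebesgue) \<le> ennreal \<delta>"
    using diff by (simp add: h_def norm_minus_commute)
  then have hfin: "(\<integral>\<^sup>+x. ennreal (norm (h x) powr p) \<partial>lebesgue) < \<infinity>"
    by (auto intro: order_le_less_trans)
  have Tg: "T g j \<le> ennreal (2 powr p) * (S + ennreal (C * \<delta>))" if "j > 0" for j
  proof -
    \<comment> \<open>Splitting the pairing needs both integrals to converge absolutely, since a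
      divergent Bochner integral has the default value 0.\<close>
    have "pairing g (affine_system q a b \<phi> j k)
        = pairing f (affine_system q a b \<phi> j k) + pairing h (affine_system q a b \<phi> j k)" for k
    proof -
      let ?\<psi> = "\<lambda>x. cnj (affine_system q a b \<phi> j k x)"
      have "integrable lebesgue (\<lambda>x. f x * ?\<psi> x)" "integrable lebesgue (\<lambda>x. h x * ?\<psi> x)"
        using C(1)[OF that f fin] C(1)[OF that _ hfin] by simp_all
      moreover have "(\<lambda>x. g x * ?\<psi> x) = (\<lambda>x. f x * ?\<psi> x + h x * ?\<psi> x)"
        by (simp add: h_def left_diff_distrib)
      ultimately show ?thesis
        by (simp only: pairing_def Bochner_Integration.integral_add)
    qed
    then have "T g j \<le> (\<Sum>\<^sub>\<infinity>k\<in>UNIV. ennreal (2 powr p) *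
        (ennreal (norm (pairing f (affine_system q a b \<phi> j k)) powr p) +
         ennreal (norm (pairing h (affine_system q a b \<phi> j k)) powr p)))"
      unfolding T_def using norm_add_powr_le[of p] p
      by (intro infsum_ennreal_mono)
         (simp add: ennreal_mult[symmetric] ennreal_plus[symmetric] del: ennreal_plus)
    also have "\<dots> = ennreal (2 powr p) * (T f j + T h j)"
      by (simp add: T_def infsum_cmult_ennreal infsum_eq_nn_integral_count_space nn_integral_add
          nn_integral_cmult)
    also have "\<dots> \<le> ennreal (2 powr p) * (S + ennreal (C * \<delta>))"
    proof (intro mult_left_mono add_mono)
      show "T f j \<le> S"
        unfolding S_def using that by (intro SUP_upper) simp
      have "T h j \<le> ennreal C * (\<integral>\<^sup>+x. ennreal (norm (h x) powr p) \<partial>lebesgue)"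
        using C(1)[OF that _ hfin] by simp
      also have "\<dots> \<le> ennreal C * ennreal \<delta>"
        using h by (rule mult_left_mono) simp
      finally show "T h j \<le> ennreal (C * \<delta>)"
        using C(2) \<delta>(1) by (simp add: ennreal_mult)
    qed simp
    finally show ?thesis .
  qed
  have "(\<integral>\<^sup>+x. ennreal (norm (g x) powr p) \<partial>lebesgue) \<le> ennreal \<bar>det b\<bar> * (SUP j\<in>{0<..}. T g j)"
    unfolding T_def by (rule nn_integral_norm_powr_le_coefficients[OF inv exp b p q \<phi> g])
  also have "\<dots> \<le> ennreal \<bar>det b\<bar> * (ennreal (2 powr p) * (S + ennreal (C * \<delta>)))"
    using Tg by (intro mult_left_mono SUP_least) auto
  finally have Ng: "(\<integral>\<^sup>+x. ennreal (norm (g x) powr p) \<partial>lebesgue)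
      \<le> ennreal \<bar>det b\<bar> * (ennreal (2 powr p) * (S + ennreal (C * \<delta>)))" .
  have "(\<integral>\<^sup>+x. ennreal (norm (f x) powr p) \<partial>lebesgue)
      \<le> ennreal (2 powr p) * ((\<integral>\<^sup>+x. ennreal (norm (f x - g x) powr p) \<partial>lebesgue)
        + (\<integral>\<^sup>+x. ennreal (norm (g x) powr p) \<partial>lebesgue))"
    using nn_integral_norm_add_powr_le[of p "\<lambda>x. f x - g x" lebesgue g] p by simp
  also have "\<dots> \<le> ennreal (2 powr p) * (ennreal \<delta>
      + ennreal \<bar>det b\<bar> * (ennreal (2 powr p) * (S + ennreal (C * \<delta>))))"
    using diff Ng by (intro mult_left_mono add_mono) auto
  also have "\<dots> = ennreal (2 powr p * \<bar>det b\<bar> * 2 powr p) * S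
      + (ennreal (2 powr p) * ennreal \<delta> + ennreal (2 powr p) * (ennreal \<bar>det b\<bar> * (ennreal (2 powr p) * ennreal (C * \<delta>))))"
    by (simp add: ennreal_mult distrib_left mult_ac add_ac)
  also have "ennreal (2 powr p) * ennreal \<delta> + ennreal (2 powr p) * (ennreal \<bar>det b\<bar> * (ennreal (2 powr p) * ennreal (C * \<delta>)))
      = ennreal (L * \<delta>)"
    using \<delta>(1) C(2) by (simp add: ennreal_mult[symmetric] ennreal_plus[symmetric] L_def algebra_simps del: ennreal_plus)
  finally show "(\<integral>\<^sup>+x. ennreal (norm (f x) powr p) \<partial>lebesgue)
      \<le> ennreal (2 powr p * \<bar>det b\<bar> * 2 powr p) * (SUP j\<in>{0<..}. T f j) + ennreal e"
    unfolding S_def \<delta>(2) .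
qed

section \<open>Powers and conjugate exponents in [0, infinity]\<close>

lemma epowr_ennreal [simp]: "0 \<le> t \<Longrightarrow> epowr (ennreal t) r = ennreal (t powr r)"
  by (simp add: epowr_def)

lemma epowr_top [simp]: "epowr top r = top"
  by (simp add: epowr_def)

lemma epowr_mono:
  assumes "0 \<le> r" "s \<le> t"
  shows "epowr s r \<le> epowr t r"
proof (cases t)
  case (real y)
  with assms(2) obtain x where "s = ennreal x" "0 \<le> x"
    by (metis ennreal_cases ennreal_less_top leD)
  with real assms show ?thesis
    by (simp add: powr_mono2 ennreal_leI)
qed simp

lemma epowr_cmult:
  assumes "0 < c"
  shows "epowr (ennreal c * t) r = ennreal (c powr r) * epowr t r"
  using assms by (cases t) (simp_all add: ennreal_mult[symmetric] powr_mult ennreal_mult_top)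

lemma epowr_epowr:
  assumes "r * s = 1"
  shows "epowr (epowr t r) s = t"
  using assms by (cases t) (simp_all add: powr_powr)

lemma epowr_less_top_iff: "epowr t r < top \<longleftrightarrow> t < top"
  by (cases t) simp_all

lemma Lp_norm_eq_epowr:
  assumes "0 \<le> p"
  shows "Lp_norm (ennreal p) M f = epowr (\<integral>\<^sup>+x. ennreal (norm (f x) powr p) \<partial>M) (1 / p)"
  using assms by (simp add: Lp_norm_def eLp_norm_def)

text \<open>As a summand of 1, \<open>1 / q\<close> is finite, so the equation can be read in the
  reals. For \<open>p = 1\<close> it forces \<open>q = \<infinity>\<close>, and both sides of the
  conclusion are 0.\<close>

lemma ennreal_conjugate_exponent:
  assumes "1 \<le> p" "1 / ennreal p + 1 / q = 1"
  shows "enn2real (1 / q) = 1 - 1 / p"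
proof -
  have p: "1 / ennreal p = ennreal (1 / p)"
    using assms(1) divide_ennreal[of 1 p] by simp
  have "1 / q \<noteq> top"
    using assms(2) by (metis ennreal_add_eq_top ennreal_one_neq_top)
  then obtain r where r: "1 / q = ennreal r" "0 \<le> r"
    by (cases "1 / q") auto
  then have "ennreal (1 / p + r) = ennreal 1"
    using assms p by (simp add: ennreal_plus[symmetric] del: ennreal_plus)
  then have "1 / p + r = 1"
    using r assms(1) by (subst (asm) ennreal_inj) auto
  then show ?thesis
    using r by simp
qed

theorem corollary6:
  fixes a :: "nat \<Rightarrow> real ^ 'd ^ 'd" and b :: "real ^ 'd ^ 'd"
    and p :: real and q :: ennreal and \<phi> :: "real ^ 'd \<Rightarrow> complex"
  assumes "\<And>j. j > 0 \<Longrightarrow> invertible (a j)"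
    and "expanding a"
    and "invertible b"
    and "1 \<le> p"
    and "1 / ennreal p + 1 / q = 1"
    and "\<phi> \<in> Lp_space q lebesgue"
    and "periodization b (\<lambda>x. ennreal (norm (\<phi> x))) \<in> eLp_space \<infinity> lebesgue"
    and "(\<integral>x. \<phi> x \<partial>lebesgue) = 1"
  shows "\<exists>C1 C2 :: real. C1 > 0 \<and> C2 > 0 \<and>
    (\<forall>f \<in> Lp_space (ennreal p) lebesgue.
       Lp_norm (ennreal p) lebesgue f \<le> ennreal C1 * linf_lp_norm p (analysis_op q a b \<phi> f) \<and>
       linf_lp_norm p (analysis_op q a b \<phi> f) \<le> ennreal C2 * Lp_norm (ennreal p) lebesgue f \<and>
       linf_lp_norm p (analysis_op q a b \<phi> f) =
         (SUP j\<in>{0<..}. epowr (\<Sum>\<^sub>\<infinity>k\<in>UNIV.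
            ennreal (norm (pairing f (affine_system q a b \<phi> j k)) powr p)) (1 / p)) *
         ennreal \<bar>det b\<bar>)"
proof -
  note inv = assms(1) and exp = assms(2) and b = assms(3) and p = assms(4) and int1 = assms(8)
  have q: "enn2real (1 / q) = 1 - 1 / p"
    using ennreal_conjugate_exponent assms(4,5) .
  define d where "d = \<bar>det b\<bar>"
  have d: "d > 0"
    using b by (simp add: d_def invertible_det_nz)
  have [measurable]: "\<phi> \<in> borel_measurable lebesgue"
    using assms(6) by (simp add: Lp_space_def)
  \<comment> \<open>the integral of a non-integrable function is 0\<close>
  have int: "integrable lebesgue \<phi>"
    using int1 not_integrable_integral_eq by fastforce
  define W where "W = (\<integral>x. norm (\<phi> x) \<partial>lebesgue)"
  \<comment> \<open>The integral of \<open>\<phi>\<close> has modulus 1; this makes the mass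
    \<open>W\<close> positive, as the weighted Jensen inequality requires.\<close>
  have "1 \<le> W"
    using integral_norm_bound[of lebesgue \<phi>] int1 by (simp add: W_def)
  then have W: "(\<integral>\<^sup>+x. ennreal (norm (\<phi> x)) \<partial>lebesgue) = ennreal W" "0 < W"
    using int by (simp_all add: W_def nn_integral_eq_integral)
  let ?P = "periodization b (\<lambda>x. ennreal (norm (\<phi> x)))"
  obtain E where E: "esssup lebesgue ?P = ennreal E" "0 \<le> E"
    using assms(7) by (cases "esssup lebesgue ?P") (auto simp: eLp_space_def eLp_norm_def)
  \<comment> \<open>Division by \<open>d\<close> undoes the factor in \<open>periodization\<close>.
    The summand 1 makes \<open>M\<close>, and with it \<open>C\<close> and \<open>C2\<close>,
    positive without an argument that \<open>E\<close> is.\<close>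
  define M where "M = E / d + 1"
  have "M > 0"
    using E d by (simp add: M_def add_nonneg_pos)
  have "AE x in lebesgue. ?P x \<le> ennreal E"
    unfolding E(1)[symmetric] by (rule esssup_AE)
  then have M: "AE x in lebesgue. (\<Sum>\<^sub>\<infinity>k\<in>UNIV. ennreal (norm (\<phi> (x - b *v vec_of_int k)))) \<le> ennreal M"
  proof eventually_elim
    case (elim x)
    let ?s = "\<Sum>\<^sub>\<infinity>k\<in>UNIV. ennreal (norm (\<phi> (x - b *v vec_of_int k)))"
    have "?s = ennreal (1 / d) * (ennreal d * ?s)"
      using d by (simp add: mult.assoc[symmetric] ennreal_mult[symmetric])
    also have "\<dots> \<le> ennreal (1 / d) * ennreal E"
      using elim by (intro mult_left_mono) (auto simp: periodization_def d_def)
    also have "\<dots> \<le> ennreal M"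
      using E d by (simp add: M_def ennreal_mult[symmetric] ennreal_leI)
    finally show ?case .
  qed
  define T where "T f j = (\<Sum>\<^sub>\<infinity>k\<in>UNIV. ennreal (norm (pairing f (affine_system q a b \<phi> j k)) powr p))" for f j
  define N where "N f = (\<integral>\<^sup>+x. ennreal (norm (f x) powr p) \<partial>lebesgue)" for f :: "real ^ 'd \<Rightarrow> complex"
  define C where "C = W powr (p - 1) * M"
  have C: "C > 0"
    using W \<open>M > 0\<close> by (simp add: C_def)
  have bound: "(\<forall>k. integrable lebesgue (\<lambda>x. f x * cnj (affine_system q a b \<phi> j k x))) \<and> T f j \<le> ennreal C * N f"
    if "j > 0" "f \<in> borel_measurable lebesgue" "N f < \<infinity>" for j f
    using analysis_coefficients_bound[OF _ p q _ that(2) W M, of a j] that inv[of j] \<open>M > 0\<close>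
    by (simp add: T_def C_def N_def invertible_det_nz less_imp_le)
  define K where "K = 2 powr p * d * 2 powr p"
  have K: "K > 0"
    using d by (simp add: K_def)
  have lower: "N f \<le> ennreal K * (SUP j\<in>{0<..}. T f j)"
    if "f \<in> borel_measurable lebesgue" "N f < \<infinity>" for f
    unfolding T_def N_def K_def d_def
    by (rule Lp_power_le_coefficients[OF inv exp b p q int int1 bound[unfolded T_def N_def]])
       (use that C in \<open>auto simp: N_def less_imp_le\<close>)
  define Q where "Q f = (SUP j\<in>{0<..}. epowr (T f j) (1 / p))" for f
  have norm_op: "linf_lp_norm p (analysis_op q a b \<phi> f) = Q f * ennreal d" for f
  proof -
    have "(\<Sum>\<^sub>\<infinity>k\<in>UNIV. ennreal (norm (analysis_op q a b \<phi> f j k) powr p)) = ennreal (d powr p) * T f j" for j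
      by (simp add: analysis_op_def norm_mult powr_mult ennreal_mult T_def d_def infsum_cmult_ennreal)
    moreover have "epowr (ennreal (d powr p) * T f j) (1 / p) = ennreal d * epowr (T f j) (1 / p)" for j
      using d p by (simp add: epowr_cmult powr_powr)
    ultimately show ?thesis
      by (simp add: linf_lp_norm_def Q_def SUP_mult_left_ennreal mult.commute)
  qed
  \<comment> \<open>These are \<open>p\<close>-th roots of the constants for \<open>p\<close>-th
    powers; the norm of the analysis operator carries an extra factor \<open>d\<close>, divided out
    in \<open>C1\<close> and included in \<open>C2\<close>.\<close>
  define C1 C2 where "C1 = K powr (1 / p) / d" and "C2 = C powr (1 / p) * d"
  have "C1 > 0" "C2 > 0"
    using K C d by (auto simp: C1_def C2_def)
  moreover have "Lp_norm (ennreal p) lebesgue f \<le> ennreal C1 * linf_lp_norm p (analysis_op q a b \<phi> f) \<and>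
      linf_lp_norm p (analysis_op q a b \<phi> f) \<le> ennreal C2 * Lp_norm (ennreal p) lebesgue f"
    if "f \<in> Lp_space (ennreal p) lebesgue" for f
  proof
    have norm_f: "Lp_norm (ennreal p) lebesgue f = epowr (N f) (1 / p)"
      using p by (simp add: Lp_norm_eq_epowr N_def)
    then have f: "f \<in> borel_measurable lebesgue" "N f < \<infinity>"
      using that by (auto simp: Lp_space_def epowr_less_top_iff)
    \<comment> \<open>The supremum in \<open>lower\<close> is taken before the \<open>p\<close>-th
      root, the one in \<open>Q f\<close> after it. Bounding each term by
      \<open>epowr (Q f) p\<close> exchanges the two by monotonicity alone.\<close>
    have "T f j \<le> epowr (Q f) p" if "j > 0" for j
    proof -
      have "T f j = epowr (epowr (T f j) (1 / p)) p"
        using p by (simp add: epowr_epowr)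
      also have "\<dots> \<le> epowr (Q f) p"
        unfolding Q_def using p that by (intro epowr_mono SUP_upper) auto
      finally show ?thesis .
    qed
    then have "N f \<le> ennreal K * epowr (Q f) p"
      using lower[OF f] by (elim order_trans) (intro mult_left_mono SUP_least, auto)
    then have "epowr (N f) (1 / p) \<le> epowr (ennreal K * epowr (Q f) p) (1 / p)"
      using p by (intro epowr_mono) auto
    also have "\<dots> = ennreal (K powr (1 / p)) * Q f"
      using p K by (simp add: epowr_cmult epowr_epowr)
    also have "\<dots> = ennreal (C1 * d) * Q f"
      using d by (simp add: C1_def)
    also have "\<dots> = ennreal C1 * (Q f * ennreal d)"
      using \<open>C1 > 0\<close> d by (simp add: ennreal_mult mult_ac)
    finally show "Lp_norm (ennreal p) lebesgue f \<le> ennreal C1 * linf_lp_norm p (analysis_op q a b \<phi> f)"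
      unfolding norm_f norm_op .
    have "Q f \<le> epowr (ennreal C * N f) (1 / p)"
      unfolding Q_def using bound[OF _ f] p by (intro SUP_least epowr_mono) auto
    also have "\<dots> = ennreal (C powr (1 / p)) * epowr (N f) (1 / p)"
      by (rule epowr_cmult[OF C])
    finally have "Q f * ennreal d \<le> ennreal (C powr (1 / p)) * epowr (N f) (1 / p) * ennreal d"
      by (rule mult_right_mono) simp
    also have "\<dots> = ennreal C2 * epowr (N f) (1 / p)"
      using d by (simp add: C2_def ennreal_mult mult_ac)
    finally show "linf_lp_norm p (analysis_op q a b \<phi> f) \<le> ennreal C2 * Lp_norm (ennreal p) lebesgue f"
      unfolding norm_f norm_op .
  qed
  moreover have "linf_lp_norm p (analysis_op q a b \<phi> f) =
      (SUP j\<in>{0<..}. epowr (\<Sum>\<^sub>\<infinity>k\<in>UNIV.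
         ennreal (norm (pairing f (affine_system q a b \<phi> j k)) powr p)) (1 / p)) * ennreal \<bar>det b\<bar>" for f
    using norm_op[of f] unfolding Q_def T_def d_def .
  ultimately show ?thesis
    by blast
qed

end
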